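(* Let $T$ be a (finite) tree. Then $$\operatorname{ex}_{\mathcal P}(n,T,\emptyset)=\Theta\big(n^{\beta(T)}\big)\qquad (n\to\infty),$$ where the implied constants may depend on $T$.
   Context: All graphs are finite and simple. For a graph $H$ and a family $\mathcal F$ of graphs, $\operatorname{ex}_{\mathcal P}(n,H,\mathcal F)$ denotes the maximum number of copies of $H$ (subgraphs isomorphic to $H$, not necessarily induced) in an $n$-vertex planar graph that contains no member of $\mathcal F$ as a subgraph (not necessarily induced). In particular $\operatorname{ex}_{\mathcal P}(n,H,\emptyset)$ is the maximum number of copies of $H$ in an $n$-vertex planar graph. For a graph $H$, $\beta(H)$ denotes the maximum size of an independent set of $H$ all of whose vertices have degree at most $2$ in $H$. The notation $g(n)=\Theta(n^k)$ means that there are constants $c,C>0$ with $c\,n^k\le g(n)\le C\,n^k$ for all sufficiently large $n$. *)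

theory Defs
  imports "HOL-Analysis.Analysis" "HOL-Library.Landau_Symbols"
begin

type_synonym 'a graph = "'a set \<times> 'a set set"

abbreviation verts :: "'a graph \<Rightarrow> 'a set" where
  "verts G \<equiv> fst G"

abbreviation edges :: "'a graph \<Rightarrow> 'a set set" where
  "edges G \<equiv> snd G"

definition simple_graph :: "'a graph \<Rightarrow> bool" where
  "simple_graph G \<longleftrightarrow>
     finite (verts G) \<and> (\<forall>e\<in>edges G. e \<subseteq> verts G \<and> card e = 2)"

definition subgraph :: "'a graph \<Rightarrow> 'a graph \<Rightarrow> bool" where
  "subgraph K G \<longleftrightarrow> simple_graph K \<and> verts K \<subseteq> verts G \<and> edges K \<subseteq> edges G"

definition graph_iso :: "'a graph \<Rightarrow> 'b graph \<Rightarrow> bool" where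
  "graph_iso H K \<longleftrightarrow>
     (\<exists>f. bij_betw f (verts H) (verts K) \<and> edges K = (\<lambda>e. f ` e) ` edges H)"

text \<open>Copies are counted as subgraphs, not as embeddings: two embeddings with the same image
  give the same copy. They need not be induced.\<close>

definition copies :: "'a graph \<Rightarrow> 'b graph \<Rightarrow> 'b graph set" where
  "copies H G = {K. subgraph K G \<and> graph_iso H K}"


text \<open>A graph is planar if it can be drawn in the plane, here \<^typ>\<open>complex\<close>: vertices are
  distinct points, an edge is an arc (injective path) joining its two ends and passing through
  no other vertex, and two different edges meet at most in a common end.\<close>

definition planar_drawing :: "'a graph \<Rightarrow> ('a \<Rightarrow> complex) \<Rightarrow> ('a set \<Rightarrow> real \<Rightarrow> complex) \<Rightarrow> bool" where
  "planar_drawing G p \<gamma> \<longleftrightarrow>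
     inj_on p (verts G) \<and>
     (\<forall>e\<in>edges G. arc (\<gamma> e) \<and> {pathstart (\<gamma> e), pathfinish (\<gamma> e)} = p ` e \<and>
        path_image (\<gamma> e) \<inter> p ` verts G = p ` e) \<and>
     (\<forall>e\<in>edges G. \<forall>e'\<in>edges G. e \<noteq> e' \<longrightarrow>
        path_image (\<gamma> e) \<inter> path_image (\<gamma> e') \<subseteq> p ` (e \<inter> e'))"

definition planar :: "'a graph \<Rightarrow> bool" where
  "planar G \<longleftrightarrow> simple_graph G \<and> (\<exists>p \<gamma>. planar_drawing G p \<gamma>)"


definition graph_connected :: "'a graph \<Rightarrow> bool" where
  "graph_connected G \<longleftrightarrow> verts G \<noteq> {} \<and>
     (\<forall>u\<in>verts G. \<forall>v\<in>verts G. (u, v) \<in> {(x, y). {x, y} \<in> edges G}\<^sup>*)"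

definition graph_cycle :: "'a graph \<Rightarrow> 'a list \<Rightarrow> bool" where
  "graph_cycle G vs \<longleftrightarrow> length vs \<ge> 3 \<and> distinct vs \<and>
     (\<forall>i. Suc i < length vs \<longrightarrow> {vs ! i, vs ! Suc i} \<in> edges G) \<and>
     {last vs, hd vs} \<in> edges G"

definition tree :: "'a graph \<Rightarrow> bool" where
  "tree G \<longleftrightarrow> simple_graph G \<and> graph_connected G \<and> (\<nexists>vs. graph_cycle G vs)"


definition vertex_degree :: "'a graph \<Rightarrow> 'a \<Rightarrow> nat" where
  "vertex_degree G v = card {e \<in> edges G. v \<in> e}"

definition independent_set :: "'a graph \<Rightarrow> 'a set \<Rightarrow> bool" where
  "independent_set G S \<longleftrightarrow> S \<subseteq> verts G \<and> (\<forall>u\<in>S. \<forall>v\<in>S. {u, v} \<notin> edges G)"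

definition beta :: "'a graph \<Rightarrow> nat" where
  "beta H = Max {card S | S. independent_set H S \<and> (\<forall>v\<in>S. vertex_degree H v \<le> 2)}"


text \<open>Every finite graph is isomorphic to one with vertices in \<^typ>\<open>nat\<close>, so host graphs and
  forbidden graphs are taken there without loss of generality.\<close>

definition planar_hosts :: "nat \<Rightarrow> nat graph set \<Rightarrow> nat graph set" where
  "planar_hosts n \<F> = {G. planar G \<and> card (verts G) = n \<and> (\<forall>F\<in>\<F>. copies F G = {})}"

definition ex_planar :: "nat \<Rightarrow> 'a graph \<Rightarrow> nat graph set \<Rightarrow> nat" where
  "ex_planar n H \<F> = Max ((\<lambda>G. card (copies H G)) ` planar_hosts n \<F>)"


text \<open>The maxima above are taken over finite sets, which are nonempty for a simple graph
  and for the empty family; \<^const>\<open>ex_planar\<close> is unspecified if no host graph is admissible.\<close>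

lemma beta_set_finite_nonempty:
  assumes "simple_graph H"
  defines "X \<equiv> {card S | S. independent_set H S \<and> (\<forall>v\<in>S. vertex_degree H v \<le> 2)}"
  shows "finite X" "X \<noteq> {}"
proof -
  have "X \<subseteq> card ` Pow (verts H)"
    by (auto simp: X_def independent_set_def)
  then show "finite X"
    using assms(1) by (auto simp: simple_graph_def intro: finite_subset)
  have "card {} \<in> X"
    unfolding X_def independent_set_def by (intro CollectI exI[of _ "{}"]) simp
  then show "X \<noteq> {}" by blast
qed

lemma card_copies_le:
  assumes "simple_graph G"
  shows "finite (copies H G)" "card (copies H G) \<le> 2 ^ card (verts G) * 2 ^ 2 ^ card (verts G)"
proof -
  have sub: "copies H G \<subseteq> Pow (verts G) \<times> Pow (Pow (verts G))"
    using assms by (force simp: copies_def subgraph_def simple_graph_def)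
  have fin: "finite (verts G)"
    using assms by (simp add: simple_graph_def)
  show "finite (copies H G)"
    by (rule finite_subset[OF sub]) (simp add: fin)
  have "card (copies H G) \<le> card (Pow (verts G) \<times> Pow (Pow (verts G)))"
    using sub fin by (intro card_mono) auto
  then show "card (copies H G) \<le> 2 ^ card (verts G) * 2 ^ 2 ^ card (verts G)"
    using fin by (simp add: card_Pow card_cartesian_product)
qed

lemma finite_copy_numbers: "finite ((\<lambda>G. card (copies H G)) ` planar_hosts n \<F>)"
proof (rule finite_subset)
  show "(\<lambda>G. card (copies H G)) ` planar_hosts n \<F> \<subseteq> {.. 2 ^ n * 2 ^ 2 ^ n}"
    using card_copies_le(2) by (fastforce simp: planar_hosts_def planar_def)
qed simp

lemma planar_hosts_nonempty: "planar_hosts n {} \<noteq> {}"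
proof -
  have "planar_drawing ({..<n}, {}) of_nat (\<lambda>_ _. 0)"
    by (simp add: planar_drawing_def)
  then have "({..<n}, {}) \<in> planar_hosts n {}"
    by (auto simp: planar_hosts_def planar_def simple_graph_def)
  then show ?thesis by blast
qed

end

theory Submission
  imports Defs
begin

text \<open>
  Lower bound: root \<open>T\<close> outside an extremal independent set \<open>S\<close> and replace each \<open>s \<in> S\<close> by
  \<open>m \<approx> n / |T|\<close> twins. As \<open>s\<close> has at most one child, the breadth-first layered drawing of \<open>T\<close> remains
  a straight-line drawing, and choosing one twin for each \<open>s\<close> gives \<open>m\<^bsup>|S|\<^esup>\<close> copies.

  Upper bound: a copy is determined by an embedding of \<open>T\<close>. The vertices of degree at most 2 are covered
  by \<open>\<beta>(T)\<close> vertices and edges of \<open>T\<close>, and a planar graph has \<open>O(n)\<close> edges, so there are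
  \<open>O(n\<^bsup>\<beta>(T)\<^esup>)\<close> ways to place them. Each placement has boundedly many extensions: otherwise three of them
  form a sunflower, and a component \<open>C\<close> of its petals has at least \<open>|C| + 2 \<ge> 3\<close> outside neighbours, since all
  degrees in \<open>C\<close> are at least 3 and \<open>T\<close> is a forest. These neighbours and the three images of \<open>C\<close> form
  a \<open>K\<^bsub>3,3\<^esub>\<close> minor with one side consisting of single vertices. Minors of this shape also
  give the linear edge bound, by contracting edges that lie in few triangles.
\<close>

section \<open>Theta curves in the plane\<close>

text \<open>The upper bound uses planarity only through \<open>planar_no_K3_model\<close>. From
  there on, contractions act on edge relations and only models are pulled back, so no drawing ever
  has to be contracted. Single vertices on one side of the minor reduce the topology to one fact
  about theta curves. Each branch set carries an arc between two of the three single vertices, and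
  the third one lies in a region of the complement whose closure misses the open part of one of
  these arcs. The exponent counts independent vertices because an edge between two vertices of
  degree at most 2 has O(n) possible images, no more in order than a single vertex has. Adjacent
  vertices of low degree therefore share one factor n. In the lower bound the same condition
  prevents crossings: twins of two adjacent vertices, or twins of a vertex with two children, would
  force the drawing of the layers to cross itself.\<close>

lemma connected_subset_inside_or_outside:
  assumes "connected X" "X \<inter> S = {}"
  shows "X \<subseteq> inside S \<or> X \<subseteq> outside S"
proof (cases "X \<inter> inside S = {}")
  case True
  then have "X \<subseteq> outside S"
    using assms(2) inside_Un_outside[of S] by blast
  then show ?thesis by blast
next
  case False
  then obtain x where x: "x \<in> X" "x \<in> inside S" by blast
  have "y \<in> inside S" if "y \<in> X" for y
  proof (rule inside_same_component[OF _ x(2)])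
    show "connected_component (- S) x y"
      unfolding connected_component_def using assms x(1) that by blast
  qed
  then show ?thesis by blast
qed

lemma connected_unbounded_subset_outside:
  assumes "connected X" "X \<inter> S = {}" "\<not> bounded X"
  shows "X \<subseteq> outside S"
proof -
  have "x \<in> outside S" if "x \<in> X" for x
  proof -
    have "X \<subseteq> connected_component_set (- S) x"
      using that assms by (intro connected_component_maximal) auto
    then have "\<not> bounded (connected_component_set (- S) x)"
      using assms(3) bounded_subset by blast
    then show ?thesis
      using that assms(2) by (auto simp: outside_def)
  qed
  then show ?thesis by blast
qed

text \<open>Inversion at \<open>w\<close> makes the punctured inside unbounded, so it lands outside
  the image curve. If the outside landed there too, the inside of the image curve could contain only
  0, the one point that the inversion does not attain; but it is open and nonempty.\<close>

lemma inversion_swaps_outside: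
  fixes c :: "real \<Rightarrow> complex"
  assumes c: "simple_path c" "pathfinish c = pathstart c"
    and w: "w \<in> inside (path_image c)" and z: "z \<in> outside (path_image c)"
  defines "f \<equiv> \<lambda>z. inverse (z - w)"
  shows "f z \<in> inside (f ` path_image c)"
proof (rule ccontr)
  assume *: "f z \<notin> inside (f ` path_image c)"
  let ?S = "path_image c"
  have J: "open (inside ?S)" "connected (inside ?S)" "connected (outside ?S)"
    using Jordan_inside_outside[OF c] by auto
  have wS: "w \<notin> ?S" "w \<notin> outside ?S"
    using w inside_no_overlap[of ?S] inside_Int_outside[of ?S] by blast+
  have inj: "inj_on f (- {w})"
    by (auto simp: inj_on_def f_def)
  have cont: "continuous_on A f" if "w \<notin> A" for A
    using that by (auto simp: f_def intro!: continuous_intros)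
  have disj: "f ` A \<inter> f ` ?S = {}" if "A \<inter> ?S = {}" "w \<notin> A" for A
    using that wS inj by (auto simp: f_def)
  have out: "f ` outside ?S \<subseteq> outside (f ` ?S)"
  proof -
    have "connected (f ` outside ?S)"
      using J wS cont by (intro connected_continuous_image) auto
    moreover have "f ` outside ?S \<inter> f ` ?S = {}"
      using wS outside_no_overlap[of ?S] by (intro disj) auto
    ultimately show ?thesis
      using connected_subset_inside_or_outside * z by blast
  qed
  have ins: "f ` (inside ?S - {w}) \<subseteq> outside (f ` ?S)"
  proof (rule connected_unbounded_subset_outside)
    show "connected (f ` (inside ?S - {w}))"
      using J cont by (intro connected_continuous_image connected_open_delete) auto
    show "f ` (inside ?S - {w}) \<inter> f ` ?S = {}"
      using inside_no_overlap[of ?S] by (intro disj) blast+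
    show "\<not> bounded (f ` (inside ?S - {w}))"
    proof
      assume "bounded (f ` (inside ?S - {w}))"
      then obtain B where B: "\<And>u. u \<in> inside ?S - {w} \<Longrightarrow> norm (f u) \<le> B" "B > 0"
        by (auto simp: bounded_pos)
      obtain e where e: "e > 0" "ball w e \<subseteq> inside ?S"
        using J w openE by blast
      \<comment> \<open>Close enough to \<open>w\<close> to stay inside the curve, and so small that
        \<open>f (w + d) = 1 / d\<close> exceeds \<open>B\<close>.\<close>
      define d where "d = min (e/2) (1 / (2*B))"
      have d: "d > 0" "d < e" "d * B < 1"
        using e B(2) by (auto simp: d_def min_def field_simps)
      have "w + of_real d \<in> inside ?S - {w}"
        using d e by (auto simp: dist_norm intro!: subsetD[OF e(2)])
      from B(1)[OF this] d have "1 / d \<le> B"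
        by (simp add: f_def norm_inverse divide_inverse)
      then show False using d by (simp add: field_simps)
    qed
  qed
  have S0: "f ` ?S = path_image (f \<circ> c)"
    by (simp add: path_image_compose)
  have sp: "simple_path (f \<circ> c)" "pathfinish (f \<circ> c) = pathstart (f \<circ> c)"
    using c wS cont[of ?S] inj_on_subset[OF inj, of ?S]
    by (auto intro!: simple_path_continuous_image simp: pathfinish_compose pathstart_compose)
  have J2: "open (inside (f ` ?S))" "inside (f ` ?S) \<noteq> {}"
    using Jordan_inside_outside[OF sp] by (auto simp: S0)
  have "inside (f ` ?S) \<subseteq> {0}"
  proof
    fix y assume y: "y \<in> inside (f ` ?S)"
    show "y \<in> {0}"
    proof (rule ccontr)
      assume "y \<notin> {0}"
      then have fy: "y = f (w + inverse y)" "w + inverse y \<noteq> w"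
        by (auto simp: f_def)
      have "w + inverse y \<notin> ?S"
        using y fy inside_no_overlap[of "f ` ?S"] by blast
      then have "w + inverse y \<in> (inside ?S - {w}) \<union> outside ?S"
        using fy(2) inside_Un_outside[of ?S] by blast
      then have "y \<in> outside (f ` ?S)"
        using fy(1) ins out by blast
      then show False using y inside_Int_outside by blast
    qed
  qed
  then have "inside (f ` ?S) = {0}" using J2 by auto
  then show False using J2 not_open_singleton[of "0::complex"] by auto
qed

text \<open>When \<open>c3\<close> runs inside the cycle of the other two, it cuts that inside into
  \<open>D1\<close> and \<open>D2\<close>. A connected set off the three arcs lies in
  \<open>D1\<close>, in \<open>D2\<close> or outside the cycle, and the closure of each of these
  regions misses one open arc: \<open>c2\<close>, \<open>c1\<close> and \<open>c3\<close>
  respectively.\<close>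

lemma theta_inside:
  fixes c1 c2 c3 :: "real \<Rightarrow> complex"
  assumes a: "arc c1" "arc c2" "arc c3"
    and s: "pathstart c1 = a" "pathstart c2 = a" "pathstart c3 = a"
    and t: "pathfinish c1 = b" "pathfinish c2 = b" "pathfinish c3 = b"
    and d: "path_image c1 \<inter> path_image c2 = {a, b}" "path_image c1 \<inter> path_image c3 = {a, b}"
      "path_image c2 \<inter> path_image c3 = {a, b}"
    and X: "connected X" "X \<inter> (path_image c1 \<union> path_image c2 \<union> path_image c3) = {}"
    and ne: "path_image c3 \<inter> inside (path_image c1 \<union> path_image c2) \<noteq> {}"
  shows "\<exists>c\<in>{c1, c2, c3}. closure X \<inter> (path_image c - {a, b}) = {}"
proof -
  let ?A = "path_image c1" and ?B = "path_image c2" and ?C = "path_image c3"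
  have ab: "a \<noteq> b" using a s t arc_distinct_ends by blast
  have cl: "closed ?A" "closed ?B" "closed ?C"
    using a closed_arc_image by auto
  define D1 where "D1 = inside (?A \<union> ?C)"
  define D2 where "D2 = inside (?B \<union> ?C)"
  define I where "I = inside (?A \<union> ?B)"
  have D: "D1 \<inter> D2 = {}" "D1 \<union> D2 \<union> (?C - {a, b}) = I"
    unfolding D1_def D2_def I_def
    using split_inside_simple_closed_curve[of c1 a b c2 c3] a s t ab d ne
    by (auto simp: arc_imp_simple_path)
  have op: "open D1" "open D2" "open I"
    using cl by (auto simp: D1_def D2_def I_def open_inside closed_Un)
  have I12: "I \<inter> (?A \<union> ?B) = {}" by (simp add: I_def inside_no_overlap)
  consider "X \<subseteq> outside (?A \<union> ?B)" | "X \<subseteq> I"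
    using connected_subset_inside_or_outside[of X "?A \<union> ?B"] X by (auto simp: I_def)
  then show ?thesis
  proof cases
    case 1
    then have "I \<inter> X = {}" using inside_Int_outside[of "?A \<union> ?B"] unfolding I_def by blast
    then have "I \<inter> closure X = {}" using open_Int_closure_eq_empty[OF op(3)] by blast
    then show ?thesis using D(2) by auto
  next
    case 2
    then have "X \<subseteq> D1 \<union> D2" using D X(2) by blast
    then consider "X \<subseteq> D1" | "X \<subseteq> D2"
      using connectedD[OF X(1) op(1,2)] D(1) by blast
    then show ?thesis
    proof cases
      case 1
      have "closure D1 \<subseteq> D1 \<union> (?A \<union> ?C)"
        using closure_inside_subset[of "?A \<union> ?C"] cl by (auto simp: D1_def closed_Un)
      then have "closure X \<subseteq> D1 \<union> ?A \<union> ?C" using closure_mono[OF 1] by blast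
      moreover have "D1 \<inter> ?B = {}" using D I12 by blast
      ultimately have "closure X \<inter> (?B - {a, b}) = {}" using d by blast
      then show ?thesis by blast
    next
      case 2
      have "closure D2 \<subseteq> D2 \<union> (?B \<union> ?C)"
        using closure_inside_subset[of "?B \<union> ?C"] cl by (auto simp: D2_def closed_Un)
      then have "closure X \<subseteq> D2 \<union> ?B \<union> ?C" using closure_mono[OF 2] by blast
      moreover have "D2 \<inter> ?A = {}" using D I12 by blast
      ultimately have "closure X \<inter> (?A - {a, b}) = {}" using d by blast
      then show ?thesis by blast
    qed
  qed
qed

text \<open>If no curve lies inside the cycle formed by the other two, an inversion at a point inside one of
  these cycles leads back to the previous case.\<close>

lemma theta_no_common_face:
  fixes c1 c2 c3 :: "real \<Rightarrow> complex"
  assumes a: "arc c1" "arc c2" "arc c3"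
    and s: "pathstart c1 = a" "pathstart c2 = a" "pathstart c3 = a"
    and t: "pathfinish c1 = b" "pathfinish c2 = b" "pathfinish c3 = b"
    and d: "path_image c1 \<inter> path_image c2 = {a, b}" "path_image c1 \<inter> path_image c3 = {a, b}"
      "path_image c2 \<inter> path_image c3 = {a, b}"
    and X: "connected X" "X \<inter> (path_image c1 \<union> path_image c2 \<union> path_image c3) = {}"
  shows "\<exists>c\<in>{c1, c2, c3}. closure X \<inter> (path_image c - {a, b}) = {}"
proof (cases "path_image c3 \<inter> inside (path_image c1 \<union> path_image c2) = {}")
  case False
  then show ?thesis using theta_inside[OF a s t d X] by blast
next
  case c3out: True
  let ?A = "path_image c1" and ?B = "path_image c2" and ?C = "path_image c3"
  let ?S = "?A \<union> ?B"
  \<comment> \<open>A closed curve with image \<open>?S\<close>, needed to apply the Jordan curve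
    theorem.\<close>
  define c where "c = c1 +++ reversepath c2"
  have c: "simple_path c" "pathfinish c = pathstart c" "path_image c = ?S"
    using a s t d(1) unfolding c_def
    by (auto simp: path_image_join simple_path_join_loop_eq arc_reversepath)
  have J: "open (outside ?S)" "inside ?S \<noteq> {}"
    using Jordan_inside_outside[OF c(1,2)] c(3) by auto
  have c3: "?C - {a, b} \<subseteq> outside ?S"
  proof
    fix x assume x: "x \<in> ?C - {a, b}"
    then have "x \<notin> ?A" "x \<notin> ?B" using d(2,3) by blast+
    moreover have "x \<notin> inside ?S" using x c3out by blast
    ultimately show "x \<in> outside ?S" unfolding outside_inside by blast
  qed
  consider "X \<subseteq> inside ?S" | "X \<subseteq> outside ?S"
    using connected_subset_inside_or_outside[of X ?S] X by blast
  then show ?thesis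
  proof cases
    case 1
    then have "outside ?S \<inter> X = {}" using inside_Int_outside[of ?S] by blast
    then have "outside ?S \<inter> closure X = {}" using open_Int_closure_eq_empty[OF J(1)] by simp
    then have "closure X \<inter> (?C - {a, b}) = {}" using c3 by blast
    then show ?thesis by blast
  next
    \<comment> \<open>Both \<open>X\<close> and \<open>c3\<close> lie outside the cycle. Inversion
      at a point inside it carries \<open>c3\<close> to the inside of the image cycle, where
      \<open>theta_inside\<close> applies.\<close>
    case Xout: 2
    obtain w where w: "w \<in> inside ?S" using J(2) by blast
    define f where "f = (\<lambda>z. inverse (z - w))"
    have wn: "w \<notin> ?A" "w \<notin> ?B" "w \<notin> ?C" "w \<notin> X"
    proof -
      show "w \<notin> ?A" "w \<notin> ?B" using w inside_no_overlap[of ?S] by blast+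
      show "w \<notin> ?C" using w c3out by blast
      show "w \<notin> X" using w Xout inside_Int_outside[of ?S] by blast
    qed
    have inj: "inj_on f (- {w})"
      by (auto simp: inj_on_def f_def)
    have cont: "continuous_on A f" if "w \<notin> A" for A
      using that by (auto simp: f_def intro!: continuous_intros)
    have arcf: "arc (f \<circ> g)" if "arc g" "w \<notin> path_image g" for g
      using that cont inj unfolding arc_def
      by (auto simp: path_image_def intro!: path_continuous_image comp_inj_on intro: inj_on_subset)
    have imf: "f ` A \<inter> f ` B = f ` (A \<inter> B)" if "w \<notin> A" "w \<notin> B" for A B
      using that inj_on_image_Int[OF inj, of A B] by auto
    have "?C - {a, b} \<noteq> {}"
      using simple_path_endless[of c3] arc_imp_simple_path[OF a(3)] nonempty_simple_path_endless[of c3] s t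
      by auto
    then obtain z where z: "z \<in> ?C" "z \<in> outside ?S" using c3 by blast
    have "f z \<in> inside (f ` ?S)"
      using inversion_swaps_outside[OF c(1,2)] w z c(3) by (auto simp: f_def)
    then have "path_image (f \<circ> c3) \<inter> inside (path_image (f \<circ> c1) \<union> path_image (f \<circ> c2)) \<noteq> {}"
      using z by (auto simp: path_image_compose image_Un)
    moreover have "connected (f ` X)"
      using X cont wn by (intro connected_continuous_image) auto
    moreover have "f ` X \<inter> (path_image (f \<circ> c1) \<union> path_image (f \<circ> c2) \<union> path_image (f \<circ> c3)) = {}"
      using imf[of X "?A \<union> ?B \<union> ?C"] X wn by (auto simp: path_image_compose image_Un)
    ultimately have "\<exists>c\<in>{f \<circ> c1, f \<circ> c2, f \<circ> c3}. closure (f ` X) \<inter> (path_image c - {f a, f b}) = {}"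
      using a s t d wn arcf
      by (intro theta_inside) (auto simp: pathstart_compose pathfinish_compose path_image_compose imf)
    then obtain e where e: "e \<in> {c1, c2, c3}" "closure (f ` X) \<inter> (f ` path_image e - {f a, f b}) = {}"
      by (auto simp: path_image_compose)
    have we: "w \<notin> path_image e" using e wn by auto
    have abe: "a \<in> path_image e" "b \<in> path_image e" using e(1) d by auto
    \<comment> \<open>Pulling the conclusion back uses only continuity of \<open>f\<close> at a
      limit point \<open>y\<close> on the arc; \<open>y\<close> differs from \<open>w\<close>
      because \<open>w\<close> is on none of the arcs.\<close>
    have "closure X \<inter> (path_image e - {a, b}) = {}"
    proof (rule ccontr)
      assume "closure X \<inter> (path_image e - {a, b}) \<noteq> {}"
      then obtain y where y: "y \<in> closure X" "y \<in> path_image e" "y \<noteq> a" "y \<noteq> b" by blast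
      have yw: "y \<noteq> w" using y we by auto
      obtain xs where xs: "\<And>n. xs n \<in> X" "xs \<longlonglongrightarrow> y"
        using y(1) closure_sequential by blast
      have "(\<lambda>n. f (xs n)) \<longlonglongrightarrow> f y"
        unfolding f_def using yw xs(2) by (auto intro!: tendsto_intros)
      then have "f y \<in> closure (f ` X)"
        using xs(1) unfolding closure_sequential by (intro exI[of _ "\<lambda>n. f (xs n)"]) auto
      moreover have "f y \<in> f ` path_image e - {f a, f b}"
        using y abe we inj by (auto simp: inj_on_def)
      ultimately show False using e(2) by blast
    qed
    then show ?thesis using e(1) by blast
  qed
qed

section \<open>Planar graphs have no \<open>K\<^bsub>3,3\<^esub>\<close> minor\<close>

definition connected_in :: "('v \<times> 'v) set \<Rightarrow> 'v set \<Rightarrow> bool" where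
  "connected_in E A \<longleftrightarrow> A \<noteq> {} \<and> (\<forall>u\<in>A. \<forall>v\<in>A. (u, v) \<in> (E \<inter> A \<times> A)\<^sup>*)"

text \<open>A \<open>K\<^bsub>|B|,3\<^esub>\<close> minor whose first side consists of the single vertices in \<open>B\<close>; the
  branch sets of the other side are \<open>A 0\<close>, \<open>A 1\<close>, \<open>A 2\<close>.\<close>

definition K3_model :: "('v \<times> 'v) set \<Rightarrow> 'v set \<Rightarrow> (nat \<Rightarrow> 'v set) \<Rightarrow> bool" where
  "K3_model E B A \<longleftrightarrow>
     (\<forall>i<3. connected_in E (A i) \<and> A i \<inter> B = {} \<and> (\<forall>b\<in>B. \<exists>a\<in>A i. (b, a) \<in> E)) \<and>
     (\<forall>i<3. \<forall>j<3. i \<noteq> j \<longrightarrow> A i \<inter> A j = {})"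

definition adj :: "'v graph \<Rightarrow> ('v \<times> 'v) set" where
  "adj G = {(x, y). {x, y} \<in> edges G}"

text \<open>Through each \<open>C i\<close> runs an arc from \<open>b 0\<close> to
  \<open>b 1\<close>, and the three arcs form a theta curve. The region of \<open>b 2\<close> stays
  away from the open part of some arc \<open>P i\<close>, yet \<open>C i\<close> and
  \<open>E i 2\<close> connect \<open>b 2\<close> to this arc without touching the other
  two.\<close>

lemma no_K33_in_plane:
  fixes C :: "nat \<Rightarrow> complex set" and E :: "nat \<Rightarrow> nat \<Rightarrow> complex set" and b :: "nat \<Rightarrow> complex"
  assumes b: "inj_on b {..<3}"
    and C: "\<And>i. i < 3 \<Longrightarrow> path_connected (C i)" "\<And>i. i < 3 \<Longrightarrow> closed (C i)"
    and E: "\<And>i j. i < 3 \<Longrightarrow> j < 3 \<Longrightarrow> path_connected (E i j)"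
      "\<And>i j. i < 3 \<Longrightarrow> j < 3 \<Longrightarrow> closed (E i j)"
    and CE: "\<And>i j. i < 3 \<Longrightarrow> j < 3 \<Longrightarrow> C i \<inter> E i j \<noteq> {}"
    and bE: "\<And>i j k. i < 3 \<Longrightarrow> j < 3 \<Longrightarrow> k < 3 \<Longrightarrow> b k \<in> E i j \<longleftrightarrow> k = j"
    and bC: "\<And>i j. i < 3 \<Longrightarrow> j < 3 \<Longrightarrow> b j \<notin> C i"
    and EE: "\<And>i. i < 3 \<Longrightarrow> E i 0 \<inter> E i 1 \<subseteq> C i"
    and WW: "\<And>i i'. i < 3 \<Longrightarrow> i' < 3 \<Longrightarrow> i \<noteq> i' \<Longrightarrow>
      (C i \<union> (\<Union>j<3. E i j)) \<inter> (C i' \<union> (\<Union>j<3. E i' j)) \<subseteq> b ` {..<3}"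
  shows False
proof -
  have b01: "b 0 \<noteq> b 1" "b 0 \<noteq> b 2" "b 1 \<noteq> b 2"
    using inj_onD[OF b, of 0 1] inj_onD[OF b, of 0 2] inj_onD[OF b, of 1 2] by auto
  have img: "b ` {..<3} = {b 0, b 1, b 2}"
    by (auto simp: numeral_3_eq_3 lessThan_Suc numeral_2_eq_2)
  have "\<exists>g. arc g \<and> pathstart g = b 0 \<and> pathfinish g = b 1 \<and> path_image g \<subseteq> C i \<union> E i 0 \<union> E i 1"
    if i: "i < 3" for i
  proof -
    have "path_connected (C i \<union> E i 0 \<union> E i 1)"
      using C E CE[OF i, of 0] CE[OF i, of 1] i
      by (intro path_connected_Un) auto
    moreover have "b 0 \<in> C i \<union> E i 0 \<union> E i 1" "b 1 \<in> C i \<union> E i 0 \<union> E i 1"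
      using bE i by auto
    ultimately show ?thesis using b01(1) unfolding path_connected_arcwise by blast
  qed
  then obtain P where P: "\<And>i. i < 3 \<Longrightarrow> arc (P i)" "\<And>i. i < 3 \<Longrightarrow> pathstart (P i) = b 0"
     "\<And>i. i < 3 \<Longrightarrow> pathfinish (P i) = b 1"
     "\<And>i. i < 3 \<Longrightarrow> path_image (P i) \<subseteq> C i \<union> E i 0 \<union> E i 1"
    by metis
  let ?P = "\<lambda>i. path_image (P i)"
  have b2P: "b 2 \<notin> ?P i" if "i < 3" for i
    using P(4)[OF that] bC[OF that, of 2] bE[OF that, of _ 2] by auto
  have bP: "b 0 \<in> ?P i" "b 1 \<in> ?P i" if "i < 3" for i
    using P that pathstart_in_path_image[of "P i"] pathfinish_in_path_image[of "P i"] by auto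
  have PW: "?P i \<subseteq> C i \<union> (\<Union>j<3. E i j)" if "i < 3" for i
    using P(4)[OF that] by force
  \<comment> \<open>An arc avoiding \<open>C i\<close> would be covered by the closed sets
    \<open>E i 0\<close> and \<open>E i 1\<close>, which are disjoint off \<open>C i\<close>;
    connectedness forbids this.\<close>
  have PC: "?P i \<inter> C i \<noteq> {}" if i: "i < 3" for i
  proof
    assume 0: "?P i \<inter> C i = {}"
    have "connected (?P i)" using P(1)[OF i] connected_arc_image by blast
    moreover have "closed (E i 0)" "closed (E i 1)" using E i by auto
    moreover have "?P i \<subseteq> E i 0 \<union> E i 1" using P(4)[OF i] 0 by blast
    moreover have "E i 0 \<inter> E i 1 \<inter> ?P i = {}" using EE[OF i] 0 by blast
    moreover have "b 0 \<in> E i 0 \<inter> ?P i" "b 1 \<in> E i 1 \<inter> ?P i" using bE[OF i] bP[OF i] by auto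
    ultimately show False unfolding connected_closed by blast
  qed
  have PP: "?P i \<inter> ?P j = {b 0, b 1}" if "i < 3" "j < 3" "i \<noteq> j" for i j
  proof
    have "?P i \<inter> ?P j \<subseteq> b ` {..<3}"
      using PW[OF that(1)] PW[OF that(2)] by (intro order_trans[OF Int_mono WW[OF that]])
    then show "?P i \<inter> ?P j \<subseteq> {b 0, b 1}"
      using b2P[OF that(1)] unfolding img by blast
    show "{b 0, b 1} \<subseteq> ?P i \<inter> ?P j"
      using bP[OF that(1)] bP[OF that(2)] by blast
  qed
  define \<Theta> where "\<Theta> = ?P 0 \<union> ?P 1 \<union> ?P 2"
  have \<Theta>i: "x \<in> \<Theta> \<longleftrightarrow> (\<exists>i<3. x \<in> ?P i)" for x
    by (auto simp: \<Theta>_def numeral_3_eq_3 less_Suc_eq numeral_2_eq_2)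
  have cl\<Theta>: "closed \<Theta>" unfolding \<Theta>_def by (intro closed_Un closed_arc_image P(1)) auto
  define X where "X = connected_component_set (- \<Theta>) (b 2)"
  have b2: "b 2 \<in> - \<Theta>" using b2P by (auto simp: \<Theta>i)
  have Xc: "X \<in> components (- \<Theta>)" unfolding X_def components_def using b2 by blast
  have X: "connected X" "X \<inter> \<Theta> = {}" "open X" "frontier X \<subseteq> \<Theta>" "b 2 \<in> X"
    using Xc cl\<Theta> in_components_connected in_components_subset open_components
      frontier_of_components_closed_complement b2 by (blast, blast, blast, blast, simp add: X_def)
  have "\<exists>g\<in>{P 0, P 1, P 2}. closure X \<inter> (path_image g - {b 0, b 1}) = {}"
    using X(2) unfolding \<Theta>_def
    by (intro theta_no_common_face P(1-3) PP X(1)) simp_all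
  then obtain g where g: "g \<in> {P 0, P 1, P 2}" "closure X \<inter> (path_image g - {b 0, b 1}) = {}" ..
  from g(1) have "\<exists>i<3. g = P i"
    by (elim insertE emptyE) (auto intro: exI[of _ "0::nat"] exI[of _ "1::nat"] exI[of _ "2::nat"])
  then obtain i where i: "i < 3" "closure X \<inter> (?P i - {b 0, b 1}) = {}"
    using g(2) by blast
  \<comment> \<open>This connection from \<open>b 2\<close> meets the theta curve only in the open
    part of \<open>P i\<close>, which \<open>closure X\<close> misses. It can therefore never leave
    \<open>X\<close>, although it meets \<open>P i\<close> inside \<open>C i\<close>.\<close>
  let ?W = "C i \<union> E i 2"
  have "connected ?W"
    using C E CE i by (intro path_connected_imp_connected path_connected_Un) auto
  moreover have "?W \<inter> \<Theta> \<subseteq> ?P i - {b 0, b 1}"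
  proof
    fix x assume x: "x \<in> ?W \<inter> \<Theta>"
    then obtain k where k: "k < 3" "x \<in> ?P k" by (auto simp: \<Theta>i)
    have nb: "b 0 \<notin> ?W" "b 1 \<notin> ?W" using bC[OF i(1)] bE[OF i(1)] by auto
    have "k = i"
    proof (rule ccontr)
      assume "k \<noteq> i"
      then have "x \<in> b ` {..<3}" using WW[of i k] PW[OF k(1)] k x i(1) by fastforce
      then show False using nb x b2P[OF k(1)] k(2) img by auto
    qed
    then show "x \<in> ?P i - {b 0, b 1}" using k nb x by auto
  qed
  moreover have "closure X \<subseteq> X \<union> \<Theta>"
    using X(4) closure_Un_frontier[of X] by blast
  ultimately have "connected ?W" "?W \<subseteq> X \<union> (- closure X)" "b 2 \<in> X \<inter> ?W"
    using i(2) bE[OF i(1), of 2 2] X(5) by (blast, blast, auto)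
  then have "?W \<subseteq> X"
    using connectedD[of ?W X "- closure X"] X(3) closure_subset[of X] by blast
  then show False using PC[OF i(1)] X(2) \<Theta>i i(1) by blast
qed

lemma planar_drawing_facts:
  assumes "planar_drawing G p \<gamma>" "simple_graph G"
  shows "inj_on p (verts G)"
    and "e \<in> edges G \<Longrightarrow> arc (\<gamma> e)"
    and "e \<in> edges G \<Longrightarrow> v \<in> verts G \<Longrightarrow> p v \<in> path_image (\<gamma> e) \<longleftrightarrow> v \<in> e"
    and "e \<in> edges G \<Longrightarrow> e' \<in> edges G \<Longrightarrow> e \<noteq> e' \<Longrightarrow>
      path_image (\<gamma> e) \<inter> path_image (\<gamma> e') \<subseteq> p ` (e \<inter> e')"
proof -
  show inj: "inj_on p (verts G)" using assms unfolding planar_drawing_def by blast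
  show "e \<in> edges G \<Longrightarrow> arc (\<gamma> e)" using assms unfolding planar_drawing_def by blast
  show "e \<in> edges G \<Longrightarrow> e' \<in> edges G \<Longrightarrow> e \<noteq> e' \<Longrightarrow>
      path_image (\<gamma> e) \<inter> path_image (\<gamma> e') \<subseteq> p ` (e \<inter> e')"
    using assms unfolding planar_drawing_def by blast
  assume e: "e \<in> edges G" and v: "v \<in> verts G"
  have "path_image (\<gamma> e) \<inter> p ` verts G = p ` e" "e \<subseteq> verts G"
    using assms e unfolding planar_drawing_def simple_graph_def by blast+
  then show "p v \<in> path_image (\<gamma> e) \<longleftrightarrow> v \<in> e"
    using v inj inj_on_image_mem_iff[OF inj v] by blast
qed

text \<open>\<open>C i\<close> is the drawing of the subgraph induced by \<open>A i\<close>, and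
  \<open>E i j\<close> is the arc of one chosen edge from \<open>v j\<close> into
  \<open>A i\<close>. Arcs meet only in common ends, so the sets belonging to different branch sets
  can share only points of \<open>B\<close>.\<close>

lemma planar_no_K3_model:
  assumes "planar G" and A: "\<And>i. i < 3 \<Longrightarrow> A i \<subseteq> verts G"
    and B: "B \<subseteq> verts G" "card B = 3"
  shows "\<not> K3_model (adj G) B A"
proof
  assume M: "K3_model (adj G) B A"
  have sg: "simple_graph G" using assms(1) by (simp add: planar_def)
  obtain p \<gamma> where dr: "planar_drawing G p \<gamma>" using assms(1) by (auto simp: planar_def)
  note d = planar_drawing_facts[OF dr sg]
  have eV: "e \<subseteq> verts G" if "e \<in> edges G" for e using sg that by (auto simp: simple_graph_def)
  have finE: "finite (edges G)"
    using sg by (auto simp: simple_graph_def intro: finite_subset[of _ "Pow (verts G)"])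
  obtain v where v: "bij_betw v {..<3::nat} B"
    using B(2) ex_bij_betw_nat_finite[of B] card_ge_0_finite[of B] by (auto simp: atLeast0LessThan)
  have vB: "v j \<in> B" if "j < 3" for j using v that by (auto simp: bij_betw_def)
  have "\<exists>a\<in>A i. (v j, a) \<in> adj G" if "i < 3" "j < 3" for i j
    using M vB[OF that(2)] that by (auto simp: K3_model_def)
  then obtain a where a: "\<And>i j. i < 3 \<Longrightarrow> j < 3 \<Longrightarrow> a i j \<in> A i"
    "\<And>i j. i < 3 \<Longrightarrow> j < 3 \<Longrightarrow> {v j, a i j} \<in> edges G"
    unfolding adj_def by (metis (no_types, lifting) case_prodD mem_Collect_eq)
  have AB: "A i \<inter> B = {}" "connected_in (adj G) (A i)" if "i < 3" for i
    using M that by (auto simp: K3_model_def)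
  have AA: "A i \<inter> A j = {}" if "i < 3" "j < 3" "i \<noteq> j" for i j
    using M that by (auto simp: K3_model_def)
  define F where "F i = {e \<in> edges G. e \<subseteq> A i}" for i
  define C where "C i = p ` A i \<union> (\<Union>e\<in>F i. path_image (\<gamma> e))" for i
  define E where "E i j = path_image (\<gamma> {v j, a i j})" for i j
  show False
  proof (rule no_K33_in_plane[where C = C and E = E and b = "p \<circ> v"])
    show "inj_on (p \<circ> v) {..<3}"
      using v B(1) d(1) by (intro comp_inj_on) (auto simp: bij_betw_def intro: inj_on_subset)
    fix i :: nat assume i: "i < 3"
    show "closed (C i)"
      unfolding C_def using A[OF i] sg finE d(2)
      by (intro closed_Un finite_imp_closed closed_UN)
         (auto simp: F_def simple_graph_def closed_arc_image intro: finite_subset)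
    obtain u where u: "u \<in> A i" using AB(2)[OF i] by (auto simp: connected_in_def)
    have edge: "path_component (C i) (p x) z" if "e \<in> F i" "x \<in> e" "z \<in> path_image (\<gamma> e)" for e x z
    proof -
      have e: "e \<in> edges G" using that(1) by (simp add: F_def)
      have "path_connected (path_image (\<gamma> e))"
        using d(2)[OF e] arc_imp_path path_connected_path_image by blast
      moreover have "p x \<in> path_image (\<gamma> e)" using d(3)[OF e] eV[OF e] that(2) by blast
      ultimately have "path_component (path_image (\<gamma> e)) (p x) z"
        using that(3) by (simp add: path_connected_component)
      then show ?thesis
        by (rule path_component_of_subset[rotated]) (use that(1) in \<open>auto simp: C_def\<close>)
    qed
    have vert: "path_component (C i) (p u) (p w)" if "w \<in> A i" for w
    proof -
      have "(u, w) \<in> (adj G \<inter> A i \<times> A i)\<^sup>*"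
        using AB(2)[OF i] u that by (auto simp: connected_in_def)
      then show ?thesis
      proof induction
        case base
        then show ?case using u by (simp add: path_component_refl_eq C_def)
      next
        case (step y z)
        then have yz: "{y, z} \<in> F i" by (auto simp: F_def adj_def)
        have "p z \<in> path_image (\<gamma> {y, z})"
          using yz d(3)[of "{y, z}" z] eV[of "{y, z}"] by (auto simp: F_def)
        then show ?case using edge[OF yz] step.IH path_component_trans by (metis insertI1)
      qed
    qed
    have "path_component (C i) (p u) z" if "z \<in> C i" for z
      using that unfolding C_def
    proof (elim UnE UN_E)
      fix e assume e: "e \<in> F i" "z \<in> path_image (\<gamma> e)"
      then have "card e = 2" using sg by (auto simp: F_def simple_graph_def)
      then obtain x where "x \<in> e" by fastforce
      then show "path_component (p ` A i \<union> (\<Union>e\<in>F i. path_image (\<gamma> e))) (p u) z"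
        using edge[OF e(1) _ e(2), of x] vert[of x] e(1) path_component_trans
        unfolding C_def F_def by blast
    next
      assume "z \<in> p ` A i"
      then show "path_component (p ` A i \<union> (\<Union>e\<in>F i. path_image (\<gamma> e))) (p u) z"
        using vert unfolding C_def by blast
    qed
    then show "path_connected (C i)"
      unfolding path_connected_component by (meson path_component_sym path_component_trans)
    have pvC: "p w \<notin> C i" if "w \<in> verts G" "w \<notin> A i" for w
    proof
      assume "p w \<in> C i"
      then consider x where "x \<in> A i" "p w = p x" | e where "e \<in> F i" "p w \<in> path_image (\<gamma> e)"
        by (auto simp: C_def)
      then show False
      proof cases
        case 1
        then show ?thesis using that d(1) A[OF i] by (auto simp: inj_on_def)
      next
        case 2
        then show ?thesis using that d(3)[of e w] by (auto simp: F_def)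
      qed
    qed
    show "E i 0 \<inter> E i 1 \<subseteq> C i"
    proof -
      have "v 0 \<noteq> v 1" using v inj_onD[of v "{..<3}" 0 1] by (auto simp: bij_betw_def)
      moreover have "v 0 \<notin> A i" "v 1 \<notin> A i" using AB(1)[OF i] vB by force+
      ultimately have ne: "{v 0, a i 0} \<noteq> {v 1, a i 1}" "{v 0, a i 0} \<inter> {v 1, a i 1} \<subseteq> A i"
        using a(1)[OF i, of 0] a(1)[OF i, of 1] by auto
      have "E i 0 \<inter> E i 1 \<subseteq> p ` ({v 0, a i 0} \<inter> {v 1, a i 1})"
        using d(4)[OF a(2) a(2) ne(1)] i unfolding E_def by simp
      then show ?thesis using image_mono[OF ne(2), of p] unfolding C_def by blast
    qed
    {
      fix j :: nat assume j: "j < 3"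
      have ve: "{v j, a i j} \<in> edges G" using a(2)[OF i j] .
      show "path_connected (E i j)" "closed (E i j)"
        using d(2)[OF ve] arc_imp_path path_connected_path_image closed_arc_image
        unfolding E_def by blast+
      have "p (a i j) \<in> C i \<inter> E i j"
        using d(3)[OF ve, of "a i j"] eV[OF ve] a(1)[OF i j] unfolding E_def C_def by auto
      then show "C i \<inter> E i j \<noteq> {}" by blast
      show "(p \<circ> v) j \<notin> C i"
        using pvC[of "v j"] vB[OF j] AB(1)[OF i] B(1) by auto
      fix k :: nat assume k: "k < 3"
      have "v k \<in> {v j, a i j} \<longleftrightarrow> k = j"
        using vB[OF k] AB(1)[OF i] a(1)[OF i j] v j k by (auto simp: bij_betw_def inj_on_def)
      then show "(p \<circ> v) k \<in> E i j \<longleftrightarrow> k = j"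
        using d(3)[OF ve, of "v k"] vB[OF k] B(1) unfolding E_def by auto
    }
    fix i' :: nat assume i': "i' < 3" "i \<noteq> i'"
    \<comment> \<open>All edges drawn for one branch set, links to \<open>B\<close> included. The
      intersection of two such drawings then reduces to a comparison of single vertices and
      edges.\<close>
    define H where "H i = F i \<union> (\<lambda>j. {v j, a i j}) ` {..<3}" for i
    have W: "C k \<union> (\<Union>j<3. E k j) = p ` A k \<union> (\<Union>e\<in>H k. path_image (\<gamma> e))" for k
      by (auto simp: C_def E_def H_def)
    have H: "e \<in> edges G" "e \<subseteq> A k \<union> B" "e \<inter> A k \<noteq> {}" if "k < 3" "e \<in> H k" for k e
    proof -
      have ne: "e \<noteq> {}" if "e \<in> edges G" using sg that by (force simp: simple_graph_def)
      from that(2) consider "e \<in> edges G" "e \<subseteq> A k" | j where "j < 3" "e = {v j, a k j}"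
        unfolding H_def F_def by auto
      then have "e \<in> edges G \<and> e \<subseteq> A k \<union> B \<and> e \<inter> A k \<noteq> {}"
      proof cases
        case 1
        then show ?thesis using ne by blast
      next
        case 2
        then show ?thesis using a[OF that(1) 2(1)] vB[OF 2(1)] by simp
      qed
      then show "e \<in> edges G" "e \<subseteq> A k \<union> B" "e \<inter> A k \<noteq> {}" by auto
    qed
    have vertex: False if kl: "k < 3" "l < 3" "k \<noteq> l" "w \<in> A k" "p w \<in> p ` A l \<union> (\<Union>e\<in>H l. path_image (\<gamma> e))"
      for k l w
    proof -
      have w: "w \<in> verts G" "w \<notin> A l" "w \<notin> B"
        using A[OF kl(1)] kl(4) AA[OF kl(1-3)] AB(1)[OF kl(1)] by blast+
      have "p w \<notin> p ` A l" using w d(1) A[OF kl(2)] by (auto simp: inj_on_def)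
      then obtain e where e: "e \<in> H l" "p w \<in> path_image (\<gamma> e)" using kl(5) by blast
      then have "w \<in> e" using d(3)[OF H(1)[OF kl(2) e(1)] w(1)] by blast
      then show False using H(2)[OF kl(2) e(1)] w by blast
    qed
    show "(C i \<union> (\<Union>j<3. E i j)) \<inter> (C i' \<union> (\<Union>j<3. E i' j)) \<subseteq> (p \<circ> v) ` {..<3}"
      unfolding W
    proof
      fix x assume x: "x \<in> (p ` A i \<union> (\<Union>e\<in>H i. path_image (\<gamma> e))) \<inter>
        (p ` A i' \<union> (\<Union>e\<in>H i'. path_image (\<gamma> e)))"
      then have "x \<notin> p ` A i" "x \<notin> p ` A i'" using vertex[of i i'] vertex[of i' i] i i' by blast+
      then obtain e e' where e: "e \<in> H i" "x \<in> path_image (\<gamma> e)" "e' \<in> H i'" "x \<in> path_image (\<gamma> e')"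
        using x by blast
      note He = H[OF i e(1)] and He' = H[OF i'(1) e(3)]
      have dis: "A i \<inter> A i' = {}" using AA i i' by blast
      have "e \<noteq> e'" using He He' dis AB(1)[OF i] by blast
      then have "x \<in> p ` (e \<inter> e')" using d(4) He(1) He'(1) e by blast
      moreover have "e \<inter> e' \<subseteq> B" using He(2) He'(2) dis by blast
      moreover have "B = v ` {..<3}" using v by (auto simp: bij_betw_def)
      ultimately show "x \<in> (p \<circ> v) ` {..<3}" by (auto simp: image_comp[symmetric])
    qed
  qed
qed

section \<open>Planar graphs have linearly many edges\<close>

text \<open>Edges are ordered pairs, so \<open>card E\<close> is twice the number of edges. The
  constants in the density bounds are to be read accordingly.\<close>

definition graph_rel :: "'v set \<Rightarrow> ('v \<times> 'v) set \<Rightarrow> bool" where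
  "graph_rel V E \<longleftrightarrow> finite V \<and> E \<subseteq> V \<times> V \<and> sym E \<and> irrefl E"

definition has_K3_model :: "nat \<Rightarrow> 'v set \<Rightarrow> ('v \<times> 'v) set \<Rightarrow> bool" where
  "has_K3_model s V E \<longleftrightarrow>
     (\<exists>B A. B \<subseteq> V \<and> card B = s \<and> (\<forall>i<3. A i \<subseteq> V) \<and> K3_model E B A)"

definition contract :: "'v \<Rightarrow> 'v \<Rightarrow> ('v \<times> 'v) set \<Rightarrow> ('v \<times> 'v) set" where
  "contract x y E = {(u, v). u \<noteq> v \<and> (\<exists>a b. (a, b) \<in> E \<and>
     u = (if a = y then x else a) \<and> v = (if b = y then x else b))}"

lemma graph_relD:
  assumes "graph_rel V E"
  shows "finite V" "finite E" "(a, b) \<in> E \<Longrightarrow> a \<in> V" "(a, b) \<in> E \<Longrightarrow> b \<in> V"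
    "(a, b) \<in> E \<Longrightarrow> (b, a) \<in> E" "(a, a) \<notin> E"
proof -
  show "finite V" using assms by (simp add: graph_rel_def)
  have "finite (V \<times> V)" "E \<subseteq> V \<times> V" using assms by (auto simp: graph_rel_def)
  then show "finite E" using finite_subset by blast
qed (use assms in \<open>auto simp: graph_rel_def sym_def irrefl_def\<close>)

lemma graph_rel_restrict:
  "graph_rel V E \<Longrightarrow> W \<subseteq> V \<Longrightarrow> graph_rel W (E \<inter> W \<times> W)"
  by (auto simp: graph_rel_def sym_def irrefl_def intro: finite_subset)

lemma connected_inI:
  assumes "sym E" "x \<in> A" "\<And>v. v \<in> A \<Longrightarrow> (x, v) \<in> (E \<inter> A \<times> A)\<^sup>*"
  shows "connected_in E A"
proof -
  have "sym (E \<inter> A \<times> A)" using assms(1) by (auto simp: sym_def)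
  then have "sym ((E \<inter> A \<times> A)\<^sup>*)" by (rule sym_rtrancl)
  then show ?thesis
    unfolding connected_in_def using assms(2,3) by (meson emptyE rtrancl_trans symD)
qed

lemma connected_in_singleton: "connected_in E {a}"
  by (simp add: connected_in_def)

lemma connected_in_insert:
  assumes "sym E" "connected_in E A" "a \<in> A" "(a, y) \<in> E"
  shows "connected_in E (insert y A)"
proof (rule connected_inI[OF assms(1), of a])
  show "a \<in> insert y A" using assms(3) by simp
  fix v assume "v \<in> insert y A"
  then consider "v = y" | "v \<in> A" by blast
  then show "(a, v) \<in> (E \<inter> insert y A \<times> insert y A)\<^sup>*"
  proof cases
    case 1
    then show ?thesis using assms by auto
  next
    case 2
    then have "(a, v) \<in> (E \<inter> A \<times> A)\<^sup>*" using assms by (auto simp: connected_in_def)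
    then show ?thesis by (rule rtrancl_mono[THEN subsetD, rotated]) auto
  qed
qed

lemma contract_graph_rel:
  assumes "graph_rel V E" "(x, y) \<in> E"
  shows "graph_rel (V - {y}) (contract x y E)"
proof -
  note E = graph_relD[OF assms(1)]
  have "x \<in> V" "x \<noteq> y" using E assms(2) by blast+
  show ?thesis
    unfolding graph_rel_def
  proof (intro conjI)
    show "finite (V - {y})" using E(1) by simp
    show "contract x y E \<subseteq> (V - {y}) \<times> (V - {y})"
      using \<open>x \<in> V\<close> \<open>x \<noteq> y\<close> E(3,4) by (auto simp: contract_def split: if_splits)
    show "irrefl (contract x y E)" by (auto simp: irrefl_def contract_def)
    show "sym (contract x y E)"
    proof (rule symI)
      fix u v assume "(u, v) \<in> contract x y E"
      then obtain a b where "u \<noteq> v" "(b, a) \<in> E"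
        "u = (if a = y then x else a)" "v = (if b = y then x else b)"
        using E(5) by (auto simp only: contract_def mem_Collect_eq prod.case)
      then show "(v, u) \<in> contract x y E"
        unfolding contract_def by blast
    qed
  qed
qed

lemma contractD:
  assumes "(u, v) \<in> contract x y E" "graph_rel V E" "(x, y) \<in> E"
  shows "u \<noteq> y" "v \<noteq> y" "u \<noteq> v" "u \<noteq> x \<Longrightarrow> v \<noteq> x \<Longrightarrow> (u, v) \<in> E"
    "v = x \<Longrightarrow> (u, x) \<in> E \<or> (u, y) \<in> E" "u = x \<Longrightarrow> (x, v) \<in> E \<or> (y, v) \<in> E"
proof -
  have "x \<noteq> y" using graph_relD[OF assms(2)] assms(3) by blast
  then show "u \<noteq> y" "v \<noteq> y" "u \<noteq> v" "u \<noteq> x \<Longrightarrow> v \<noteq> x \<Longrightarrow> (u, v) \<in> E"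
    "v = x \<Longrightarrow> (u, x) \<in> E \<or> (u, y) \<in> E" "u = x \<Longrightarrow> (x, v) \<in> E \<or> (y, v) \<in> E"
    using assms(1) by (auto simp: contract_def split: if_splits)
qed

text \<open>The lost pairs are the two orientations of the contracted edge and, for each common
  neighbour \<open>z\<close>, the two orientations of the edge from \<open>y\<close> to
  \<open>z\<close>, which merge with those of the edge from \<open>x\<close> to \<open>z\<close>.
  These pairs form \<open>R\<close>; on the remaining ones the renaming is injective.\<close>

lemma card_contract:
  assumes "graph_rel V E" "(x, y) \<in> E"
  shows "card E \<le> card (contract x y E) + 2 + 2 * card (E `` {x} \<inter> E `` {y})"
proof -
  note E = graph_relD[OF assms(1)]
  define N where "N = E `` {x} \<inter> E `` {y}"
  define R where "R = {(x, y), (y, x)} \<union> ({y} \<times> N \<union> N \<times> {y})"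
  have "N \<subseteq> V" using E(4) by (auto simp: N_def)
  then have finN: "finite N" using E(1) by (rule finite_subset)
  have "card R \<le> card {(x, y), (y, x)} + card ({y} \<times> N \<union> N \<times> {y})"
    unfolding R_def by (rule card_Un_le)
  moreover have "card {(x, y), (y, x)} \<le> 2" using card_length[of "[(x, y), (y, x)]"] by simp
  moreover have "card ({y} \<times> N \<union> N \<times> {y}) \<le> card ({y} \<times> N) + card (N \<times> {y})"
    by (rule card_Un_le)
  ultimately have cR: "card R \<le> 2 + 2 * card N" by (simp add: card_cartesian_product)
  have finR: "finite R" using finN by (simp add: R_def)
  let ?q = "\<lambda>(a, b). (if a = y then x else a, if b = y then x else b)"
  have xy: "x \<noteq> y" using E(6) assms(2) by blast
  have "inj_on ?q (E - R)"
  proof (rule inj_onI)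
    fix s t assume s: "s \<in> E - R" and t: "t \<in> E - R" and q: "?q s = ?q t"
    obtain a b c d where st: "s = (a, b)" "t = (c, d)" by (meson surj_pair)
    have "a \<noteq> b" "c \<noteq> d" using s t st E(6) by auto
    moreover have "a = y \<Longrightarrow> b \<noteq> x \<and> (x, b) \<notin> E" "b = y \<Longrightarrow> a \<noteq> x \<and> (x, a) \<notin> E"
      using s st E(5) by (auto simp: R_def N_def)
    moreover have "c = y \<Longrightarrow> d \<noteq> x \<and> (x, d) \<notin> E" "d = y \<Longrightarrow> c \<noteq> x \<and> (x, c) \<notin> E"
      using t st E(5) by (auto simp: R_def N_def)
    moreover have "(a, b) \<in> E" "(c, d) \<in> E" "(b, a) \<in> E" "(d, c) \<in> E" using s t st E(5) by auto
    ultimately show "s = t" using q xy st by (auto split: if_splits)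
  qed
  moreover have "?q ` (E - R) \<subseteq> contract x y E"
  proof
    fix e assume "e \<in> ?q ` (E - R)"
    then obtain e' where e': "e' \<in> E - R" "e = ?q e'" by blast
    obtain a b where "e' = (a, b)" by (rule prod.exhaust)
    with e' have ab: "(a, b) \<in> E" "(a, b) \<notin> R"
      "e = (if a = y then x else a, if b = y then x else b)" by auto
    have "a \<noteq> b" using ab(1) E(6) by auto
    then have "(if a = y then x else a) \<noteq> (if b = y then x else b)"
      using ab(2) by (auto simp: R_def)
    then show "e \<in> contract x y E" using ab(1) unfolding ab(3) contract_def by blast
  qed
  ultimately have "card (E - R) \<le> card (contract x y E)"
    using graph_relD(2)[OF contract_graph_rel[OF assms]] by (intro card_inj_on_le)
  moreover have "card E \<le> card (E - R) + card R"
    using diff_card_le_card_Diff[OF finR, of E] by linarith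
  ultimately show ?thesis using cR by (simp add: N_def)
qed

text \<open>A walk in the contracted graph lifts step by step. A step at \<open>x\<close> that stems
  from an edge at \<open>y\<close> becomes a detour over the edge between \<open>x\<close> and
  \<open>y\<close>.\<close>

lemma connected_in_contract:
  assumes "connected_in (contract x y E) A" "graph_rel V E" "(x, y) \<in> E" "y \<notin> A"
  shows "connected_in E (if x \<in> A then insert y A else A)"
proof (cases "x \<in> A")
  case False
  have "contract x y E \<inter> A \<times> A \<subseteq> E \<inter> A \<times> A"
    using contractD[OF _ assms(2,3)] False by blast
  then have "(contract x y E \<inter> A \<times> A)\<^sup>* \<subseteq> (E \<inter> A \<times> A)\<^sup>*"
    by (rule rtrancl_mono)
  then show ?thesis
    using assms(1) False unfolding connected_in_def by auto
next
  case True
  let ?R = "E \<inter> insert y A \<times> insert y A"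
  have symE: "sym E" using assms(2) by (simp add: graph_rel_def)
  have xy: "(x, y) \<in> ?R" "(y, x) \<in> ?R" using True assms(3) symE by (auto dest: symD)
  have "connected_in E (insert y A)"
  proof (rule connected_inI[OF symE, of x])
    show "x \<in> insert y A" using True by simp
    fix v assume "v \<in> insert y A"
    then consider "v = y" | "v \<in> A" by blast
    then show "(x, v) \<in> ?R\<^sup>*"
    proof cases
      case 1
      then show ?thesis using xy by auto
    next
      case 2
      then have "(x, v) \<in> (contract x y E \<inter> A \<times> A)\<^sup>*"
        using assms(1) True by (auto simp: connected_in_def)
      then show ?thesis
      proof induction
        case base
        then show ?case by simp
      next
        case (step u w)
        then have c: "(u, w) \<in> contract x y E" "u \<in> A" "w \<in> A" by auto
        note d = contractD[OF c(1) assms(2,3)]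
        have "(u, w) \<in> ?R\<^sup>*"
        proof (cases "u = x \<or> w = x")
          case False
          then show ?thesis using d c by auto
        next
          case True
          then consider "(u, w) \<in> E" | "w = x" "(u, y) \<in> E" | "u = x" "(y, w) \<in> E"
            using d(5,6) by blast
          then show ?thesis
          proof cases
            case 1
            then show ?thesis using c by auto
          next
            case 2
            then have "(u, y) \<in> ?R" using c by blast
            then show ?thesis using xy(2) 2(1) by (meson r_into_rtrancl rtrancl_into_rtrancl)
          next
            case 3
            then have "(y, w) \<in> ?R" using c by blast
            then show ?thesis using xy(1) 3(1) by (meson r_into_rtrancl rtrancl_into_rtrancl)
          qed
        qed
        then show ?case using step.IH by (rule rtrancl_trans[rotated])
      qed
    qed
  qed
  then show ?thesis using True by simp
qed

lemma two_of_three: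
  fixes p q :: "nat \<Rightarrow> bool"
  assumes "\<And>i. i < 3 \<Longrightarrow> p i \<or> q i"
  shows "(\<exists>k<3. \<forall>i<3. i \<noteq> k \<longrightarrow> p i) \<or> (\<exists>k<3. \<forall>i<3. i \<noteq> k \<longrightarrow> q i)"
proof -
  have *: "i = 0 \<or> i = 1 \<or> i = 2" if "i < 3" for i :: nat using that by auto
  have "p 0 \<or> q 0" "p 1 \<or> q 1" "p 2 \<or> q 2" using assms by auto
  then have "(p 0 \<and> p 1) \<or> (p 0 \<and> p 2) \<or> (p 1 \<and> p 2) \<or> (q 0 \<and> q 1) \<or> (q 0 \<and> q 2) \<or> (q 1 \<and> q 2)"
    by blast
  moreover have "(0::nat) < 3" "(1::nat) < 3" "(2::nat) < 3" by auto
  ultimately show ?thesis using * by metis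
qed

text \<open>A contracted vertex that plays the role of a singleton \<open>b \<in> B\<close> has only three
  neighbours to serve, so one of its two ends keeps two of them and stays in \<open>B\<close>, while the
  other end can be moved to the third branch set.\<close>

lemma has_K3_model_contract:
  assumes gr: "graph_rel V E" and xy: "(x, y) \<in> E"
    and m: "has_K3_model s (V - {y}) (contract x y E)"
  shows "has_K3_model s V E"
proof -
  let ?E' = "contract x y E"
  note gE = graph_relD[OF gr]
  note cD = contractD[OF _ gr xy]
  have symE: "sym E" using gr by (simp add: graph_rel_def)
  obtain B A where BA: "B \<subseteq> V - {y}" "card B = s" "\<And>i. i < 3 \<Longrightarrow> A i \<subseteq> V - {y}" "K3_model ?E' B A"
    using m by (auto simp: has_K3_model_def)
  have conn: "connected_in ?E' (A i)" and AB: "A i \<inter> B = {}"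
    and adjB: "\<And>b. b \<in> B \<Longrightarrow> \<exists>a\<in>A i. (b, a) \<in> ?E'" if "i < 3" for i
    using BA(4) that by (auto simp: K3_model_def)
  have AA: "A i \<inter> A j = {}" if "i < 3" "j < 3" "i \<noteq> j" for i j
    using BA(4) that by (auto simp: K3_model_def)
  have yA: "y \<notin> A i" if "i < 3" for i using BA(3)[OF that] by auto
  have V: "x \<in> V" "y \<in> V" "x \<noteq> y" using gE(3,4,6) xy by blast+
  have finB: "finite B" using BA(1) gE(1) finite_subset by blast
  show ?thesis
  proof (cases "x \<in> B")
    case False
    \<comment> \<open>If the contracted vertex belongs to a branch set, undoing the contraction just
      adds \<open>y\<close> to it.\<close>
    define A' where "A' i = (if x \<in> A i then insert y (A i) else A i)" for i
    have "K3_model E B A'"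
      unfolding K3_model_def
    proof (intro conjI allI impI ballI)
      fix i :: nat assume i: "i < 3"
      show "connected_in E (A' i)"
        unfolding A'_def using connected_in_contract[OF conn[OF i] gr xy yA[OF i]] .
      show "A' i \<inter> B = {}" using AB[OF i] BA(1) by (auto simp: A'_def)
      {
        fix b assume b: "b \<in> B"
        then obtain a where a: "a \<in> A i" "(b, a) \<in> ?E'" using adjB[OF i] by blast
        have "b \<noteq> x" using b False by auto
        then show "\<exists>a\<in>A' i. (b, a) \<in> E"
          using cD(4,5)[OF a(2)] a(1) by (cases "a = x") (auto simp: A'_def)
      }
      fix j :: nat assume j: "j < 3" "i \<noteq> j"
      show "A' i \<inter> A' j = {}"
        using AA[OF i j] yA[OF i] yA[OF j(1)] by (auto simp: A'_def)
    qed
    moreover have "A' i \<subseteq> V" if "i < 3" for i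
      using BA(3)[OF that] V by (auto simp: A'_def)
    ultimately show ?thesis unfolding has_K3_model_def using BA(1,2) by blast
  next
    case xB: True
    have xA: "x \<notin> A i" if "i < 3" for i using AB[OF that] xB by blast
    have connE: "connected_in E (A i)" if "i < 3" for i
      using connected_in_contract[OF conn[OF that] gr xy yA[OF that]] xA[OF that] by simp
    have adjE: "\<exists>a\<in>A i. (b, a) \<in> E" if ib: "i < 3" "b \<in> B" "b \<noteq> x" for i b
    proof -
      obtain a where a: "a \<in> A i" "(b, a) \<in> ?E'" using adjB[OF ib(1,2)] by blast
      then have "a \<noteq> x" using xA ib(1) by blast
      then show ?thesis using cD(4)[OF a(2) ib(3)] a(1) by blast
    qed
    have pq: "(\<exists>a\<in>A i. (x, a) \<in> E) \<or> (\<exists>a\<in>A i. (y, a) \<in> E)" if "i < 3" for i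
      using adjB[OF that xB] cD(6) by blast
    \<comment> \<open>\<open>b\<close> is the end that keeps at least two branch sets and takes the
      place of \<open>x\<close> in \<open>B\<close>; \<open>c\<close> is the other end.\<close>
    have core: ?thesis
      if bc: "{b, c} = {x, y}" and k: "k < 3" and two: "\<And>i. i < 3 \<Longrightarrow> i \<noteq> k \<Longrightarrow> \<exists>a\<in>A i. (b, a) \<in> E"
      for b c k
    proof -
      have bcE: "(b, c) \<in> E" "(c, b) \<in> E" using bc xy gE(5) V(3) by (auto simp: doubleton_eq_iff)
      have bcV: "b \<in> V" "c \<in> V" "b \<noteq> c" using bc V by (auto simp: doubleton_eq_iff)
      have bcA: "b \<notin> A i" "c \<notin> A i" if "i < 3" for i
        using bc xA[OF that] yA[OF that] by (auto simp: doubleton_eq_iff)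
      define B' where "B' = insert b (B - {x})"
      have bB: "b \<notin> B - {x}" "c \<notin> B - {x}"
        using bc BA(1) by (auto simp: doubleton_eq_iff)
      have cB': "c \<notin> B'" using bB bcV by (auto simp: B'_def)
      have "card B' = s"
        using bB(1) finB xB BA(2) card_Suc_Diff1[OF finB xB] by (simp add: B'_def)
      moreover have "B' \<subseteq> V" using BA(1) bcV by (auto simp: B'_def)
      moreover have "\<exists>A'. (\<forall>i<3. A' i \<subseteq> V) \<and> K3_model E B' A'"
      proof (cases "\<exists>a\<in>A k. (b, a) \<in> E")
        case True
        then have all: "\<exists>a\<in>A i. (b, a) \<in> E" if "i < 3" for i using two that by blast
        have "K3_model E B' A"
          unfolding K3_model_def
        proof (intro conjI allI impI ballI)
          fix i :: nat assume i: "i < 3"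
          show "connected_in E (A i)" using connE[OF i] .
          show "A i \<inter> B' = {}" using AB[OF i] bcA[OF i] by (auto simp: B'_def)
          show "\<exists>a\<in>A i. (b', a) \<in> E" if "b' \<in> B'" for b'
            using that all[OF i] adjE[OF i] by (auto simp: B'_def)
          show "A i \<inter> A j = {}" if "j < 3" "i \<noteq> j" for j using AA i that by blast
        qed
        then show ?thesis using BA(3) by blast
      next
        case False
        then obtain a where a: "a \<in> A k" "(c, a) \<in> E"
          using pq[OF k] bc by (auto simp: doubleton_eq_iff)
        \<comment> \<open>\<open>b\<close> misses \<open>A k\<close>, so \<open>c\<close> must see
          it. Adding \<open>c\<close> to \<open>A k\<close> keeps it connected, and the edge between
          \<open>b\<close> and \<open>c\<close> supplies the missing adjacency.\<close>
        define A' where "A' = A(k := insert c (A k))"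
        have sub: "A i \<subseteq> A' i" "A' i \<subseteq> insert c (A i)" for i by (auto simp: A'_def)
        have "K3_model E B' A'"
          unfolding K3_model_def
        proof (intro conjI allI impI ballI)
          fix i :: nat assume i: "i < 3"
          show "connected_in E (A' i)"
            using connE[OF i] connected_in_insert[OF symE connE[OF k] a(1)] a(2) gE(5)
            by (auto simp: A'_def)
          show "A' i \<inter> B' = {}" using AB[OF i] bcA[OF i] sub(2)[of i] cB' by (auto simp: B'_def)
          show "\<exists>a\<in>A' i. (b', a) \<in> E" if "b' \<in> B'" for b'
          proof (cases "b' = b")
            case True
            then show ?thesis using two[OF i] bcE(1) by (cases "i = k") (auto simp: A'_def)
          next
            case False
            then show ?thesis using that adjE[OF i] sub(1)[of i] by (auto simp: B'_def)
          qed
          show "A' i \<inter> A' j = {}" if "j < 3" "i \<noteq> j" for j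
            using AA[OF i that] bcA[OF i] bcA[OF that(1)] that(2) by (auto simp: A'_def)
        qed
        moreover have "A' i \<subseteq> V" if "i < 3" for i
          using sub(2)[of i] BA(3)[OF that] bcV by auto
        ultimately show ?thesis by blast
      qed
      ultimately show ?thesis unfolding has_K3_model_def by blast
    qed
    from two_of_three[of "\<lambda>i. \<exists>a\<in>A i. (x, a) \<in> E" "\<lambda>i. \<exists>a\<in>A i. (y, a) \<in> E"] pq
    consider k where "k < 3" "\<And>i. i < 3 \<Longrightarrow> i \<noteq> k \<Longrightarrow> \<exists>a\<in>A i. (x, a) \<in> E"
      | k where "k < 3" "\<And>i. i < 3 \<Longrightarrow> i \<noteq> k \<Longrightarrow> \<exists>a\<in>A i. (y, a) \<in> E"
      by blast
    then show ?thesis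
    proof cases
      case 1
      then show ?thesis by (intro core[of x y]) auto
    next
      case 2
      then show ?thesis by (intro core[of y x]) auto
    qed
  qed
qed

text \<open>Mader's argument: contracting an edge in fewer than \<open>k\<close> triangles destroys at most \<open>k\<close> edges, that
  is \<open>2 * k\<close> pairs, so the density survives until every edge lies in \<open>k\<close> triangles.\<close>

lemma dense_has_K3_model:
  assumes loc: "\<And>(V :: 'v set) E. graph_rel V E \<Longrightarrow> E \<noteq> {} \<Longrightarrow>
      (\<And>x y. (x, y) \<in> E \<Longrightarrow> k \<le> card (E `` {x} \<inter> E `` {y})) \<Longrightarrow> has_K3_model s V E"
    and k: "0 < k"
    and "graph_rel (V :: 'v set) E" "V \<noteq> {}" "2 * k * card V \<le> card E"
  shows "has_K3_model s V E"
  using assms(3-5)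
proof (induction "card V" arbitrary: V E)
  case 0
  then show ?case using graph_relD(1) by fastforce
next
  case (Suc n)
  note E = graph_relD[OF Suc.prems(1)]
  have "card V > 0" using Suc.hyps by simp
  then have "card E > 0" using Suc.prems(3) k
    by (metis less_le_trans nat_0_less_mult_iff zero_less_numeral)
  then have ne: "E \<noteq> {}" by auto
  show ?case
  proof (cases "\<forall>x y. (x, y) \<in> E \<longrightarrow> k \<le> card (E `` {x} \<inter> E `` {y})")
    case True
    then show ?thesis using loc[OF Suc.prems(1) ne] by blast
  next
    case False
    then obtain x y where xy: "(x, y) \<in> E" "card (E `` {x} \<inter> E `` {y}) + 1 \<le> k" by (auto simp: not_le)
    have V: "x \<in> V" "y \<in> V" "x \<noteq> y" using E(3,4,6) xy(1) by blast+
    have cV: "card (V - {y}) = n" using Suc.hyps(2) V(2) E(1) by simp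
    \<comment> \<open>There are at most \<open>k - 1\<close> common neighbours, so at most
      \<open>2 + 2 * (k - 1)\<close> pairs are lost.\<close>
    have "card E \<le> card (contract x y E) + 2 * k"
      using card_contract[OF Suc.prems(1) xy(1)] xy(2) by linarith
    moreover have "2 * k * card V = 2 * k * n + 2 * k" using Suc.hyps(2)[symmetric] by simp
    ultimately have "2 * k * card (V - {y}) \<le> card (contract x y E)"
      using Suc.prems(3) unfolding cV by linarith
    then have "has_K3_model s (V - {y}) (contract x y E)"
      using Suc.hyps(1)[of "V - {y}"] contract_graph_rel[OF Suc.prems(1) xy(1)] V cV by blast
    then show ?thesis using has_K3_model_contract[OF Suc.prems(1) xy(1)] by blast
  qed
qed

text \<open>With \<open>k = 3\<close>, the two ends of any edge and three common neighbours already
  form a K_{2,3}, with singletons as branch sets.\<close>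

lemma has_K3_model_2:
  assumes "graph_rel V E" "V \<noteq> {}" "6 * card V \<le> card E"
  shows "has_K3_model 2 V E"
proof (rule dense_has_K3_model[where k = 3])
  fix V :: "'a set" and E
  assume gr: "graph_rel V E" and ne: "E \<noteq> {}"
    and N: "\<And>x y. (x, y) \<in> E \<Longrightarrow> 3 \<le> card (E `` {x} \<inter> E `` {y})"
  note E = graph_relD[OF gr]
  obtain x y where xy: "(x, y) \<in> E" using ne by auto
  have xy': "x \<noteq> y" using xy E(6) by auto
  obtain T where T: "T \<subseteq> E `` {x} \<inter> E `` {y}" "card T = 3"
    using obtain_subset_with_card_n[OF N[OF xy]] by blast
  obtain t where t: "bij_betw t {..<3::nat} T"
    using T(2) ex_bij_betw_nat_finite[of T] card_ge_0_finite[of T] by (auto simp: atLeast0LessThan)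
  have tT: "(x, t i) \<in> E" "(y, t i) \<in> E" if "i < 3" for i
    using t T(1) that by (auto simp: bij_betw_def)
  have "K3_model E {x, y} (\<lambda>i. {t i})"
    using tT t E(6) by (auto simp: K3_model_def connected_in_singleton bij_betw_def inj_on_def)
  moreover have "\<forall>i<3. {t i} \<subseteq> V" using E(4)[OF tT(1)] by simp
  moreover have "{x, y} \<subseteq> V" "card {x, y} = 2"
    using E(3)[OF xy] E(4)[OF xy] xy' by auto
  ultimately show "has_K3_model 2 V E"
    unfolding has_K3_model_def by (intro exI[of _ "{x, y}"] exI[of _ "\<lambda>i. {t i}"] conjI)
qed (use assms in auto)

lemma card_rel_sum:
  assumes "finite W" "R \<subseteq> W \<times> W"
  shows "card R = (\<Sum>u\<in>W. card (R `` {u}))"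
proof -
  have "R `` {u} \<subseteq> W" for u using assms(2) by blast
  then have "\<forall>u\<in>W. finite (R `` {u})" using assms(1) finite_subset by blast
  then have "card (SIGMA u:W. R `` {u}) = (\<Sum>u\<in>W. card (R `` {u}))"
    by (rule card_SigmaI[OF assms(1)])
  moreover have "(SIGMA u:W. R `` {u}) = R" using assms(2) by blast
  ultimately show ?thesis by (simp only:)
qed

text \<open>With \<open>k = 6\<close>, every vertex of the neighbourhood \<open>W\<close> of
  \<open>x\<close> has at least 6 neighbours in \<open>W\<close>. This is the density that
  \<open>has_K3_model_2\<close> asks for, and \<open>x\<close>, adjacent to all of \<open>W\<close>,
  becomes the third single vertex.\<close>

lemma has_K3_model_3:
  assumes "graph_rel V E" "V \<noteq> {}" "12 * card V \<le> card E"
  shows "has_K3_model 3 V E"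
proof (rule dense_has_K3_model[where k = 6])
  fix V :: "'a set" and E
  assume gr: "graph_rel V E" and ne: "E \<noteq> {}"
    and N: "\<And>x y. (x, y) \<in> E \<Longrightarrow> 6 \<le> card (E `` {x} \<inter> E `` {y})"
  note E = graph_relD[OF gr]
  obtain x y where xy: "(x, y) \<in> E" using ne by auto
  define W where "W = E `` {x}"
  define R where "R = E \<inter> W \<times> W"
  have WV: "W \<subseteq> V" "x \<in> V" "x \<notin> W" using E(3,4,6) xy unfolding W_def by blast+
  have W: "W \<noteq> {}" "finite W" using xy finite_subset[OF WV(1) E(1)] unfolding W_def by blast+
  have "R `` {u} = E `` {x} \<inter> E `` {u}" if "u \<in> W" for u
    using that by (auto simp: R_def W_def)
  then have "6 \<le> card (R `` {u})" if "u \<in> W" for u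
    using that N[of x u] by (auto simp: W_def)
  then have "(\<Sum>u\<in>W. 6) \<le> (\<Sum>u\<in>W. card (R `` {u}))" by (intro sum_mono)
  then have "6 * card W \<le> card R"
    using card_rel_sum[OF W(2), of R] by (auto simp: R_def)
  then have "has_K3_model 2 W R"
    using graph_rel_restrict[OF gr WV(1)] W by (intro has_K3_model_2) (auto simp: R_def)
  then obtain B A where BA: "B \<subseteq> W" "card B = 2" "\<forall>i<3. A i \<subseteq> W" "K3_model R B A"
    by (auto simp: has_K3_model_def)
  have RA: "connected_in E (A i)" if "connected_in R (A i)" for i
  proof -
    have "(R \<inter> A i \<times> A i)\<^sup>* \<subseteq> (E \<inter> A i \<times> A i)\<^sup>*" by (intro rtrancl_mono) (auto simp: R_def)
    then show ?thesis using that unfolding connected_in_def by blast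
  qed
  have "K3_model E (insert x B) A"
    unfolding K3_model_def
  proof (intro conjI allI impI ballI)
    fix i :: nat assume i: "i < 3"
    have Ai: "A i \<subseteq> W" using BA(3) i by blast
    have m: "connected_in R (A i)" "A i \<inter> B = {}" "\<And>b. b \<in> B \<Longrightarrow> \<exists>a\<in>A i. (b, a) \<in> R"
      using BA(4) i by (auto simp: K3_model_def)
    show "connected_in E (A i)" using m RA by blast
    show "A i \<inter> insert x B = {}" using m Ai WV(3) by blast
    show "\<exists>a\<in>A i. (b, a) \<in> E" if "b \<in> insert x B" for b
    proof (cases "b = x")
      case True
      obtain a where "a \<in> A i" using m(1) by (auto simp: connected_in_def)
      then show ?thesis using Ai True by (auto simp: W_def)
    next
      case False
      then show ?thesis using m(3)[of b] that by (auto simp: R_def)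
    qed
    show "A i \<inter> A j = {}" if "j < 3" "i \<noteq> j" for j
      using BA(4) i that by (auto simp: K3_model_def)
  qed
  moreover have "card (insert x B) = 3"
    using BA(1,2) WV(3) W(2) finite_subset[OF BA(1)] by (subst card_insert_disjoint) auto
  moreover have "insert x B \<subseteq> V" "\<forall>i<3. A i \<subseteq> V" using BA WV by blast+
  ultimately show "has_K3_model 3 V E" unfolding has_K3_model_def by blast
qed (use assms in auto)

lemma adj_graph_rel:
  assumes "simple_graph G"
  shows "graph_rel (verts G) (adj G)"
  unfolding graph_rel_def
proof (intro conjI)
  show "finite (verts G)" using assms by (simp add: simple_graph_def)
  show "adj G \<subseteq> verts G \<times> verts G" using assms by (force simp: simple_graph_def adj_def)
  show "sym (adj G)" by (auto simp: sym_def adj_def insert_commute)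
  show "irrefl (adj G)" using assms by (force simp: irrefl_def adj_def simple_graph_def)
qed

lemma planar_not_has_K3_model:
  "planar G \<Longrightarrow> \<not> has_K3_model 3 (verts G) (adj G)"
  using planar_no_K3_model unfolding has_K3_model_def by blast

lemma planar_card_adj:
  assumes "planar G"
  shows "card (adj G) \<le> 12 * card (verts G)"
proof (rule ccontr)
  assume *: "\<not> ?thesis"
  have gr: "graph_rel (verts G) (adj G)"
    using assms by (intro adj_graph_rel) (simp add: planar_def)
  have "adj G \<noteq> {}" using * by auto
  then have "verts G \<noteq> {}" using graph_relD(3)[OF gr] by fastforce
  then show False using has_K3_model_3[OF gr] planar_not_has_K3_model[OF assms] * by simp
qed

section \<open>Forests and rooted trees\<close>

definition forest :: "'v graph \<Rightarrow> bool" where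
  "forest G \<longleftrightarrow> simple_graph G \<and> (\<nexists>vs. graph_cycle G vs)"

lemma adj_iff: "(x, y) \<in> adj G \<longleftrightarrow> {x, y} \<in> edges G"
  by (simp add: adj_def)

text \<open>On a longest path in \<open>W\<close>, all neighbours of the first vertex within
  \<open>W\<close> are on the path, and two of them would close a cycle.\<close>

lemma forest_has_leaf:
  assumes "forest G" "W \<subseteq> verts G" "W \<noteq> {}"
  shows "\<exists>v\<in>W. card (adj G `` {v} \<inter> W) \<le> 1"
proof (rule ccontr)
  assume "\<not> ?thesis"
  then have deg: "2 \<le> card (adj G `` {v} \<inter> W)" if "v \<in> W" for v using that by force
  have sg: "simple_graph G" using assms(1) by (simp add: forest_def)
  note E = graph_relD[OF adj_graph_rel[OF sg]]
  have finW: "finite W" using assms(2) E(1) finite_subset by blast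
  define P where "P xs \<longleftrightarrow> xs \<noteq> [] \<and> distinct xs \<and> set xs \<subseteq> W \<and>
    (\<forall>i. Suc i < length xs \<longrightarrow> (xs ! i, xs ! Suc i) \<in> adj G)" for xs
  obtain w where "w \<in> W" using assms(3) by blast
  then have P1: "P [w]" by (simp add: P_def)
  have "length xs \<le> card W" if "P xs" for xs
    using that card_mono[OF finW, of "set xs"] by (auto simp: P_def distinct_card)
  then obtain xs where xs: "P xs" "\<And>ys. P ys \<Longrightarrow> length ys \<le> length xs"
    using ex_has_greatest_nat[of P "[w]" length "Suc (card W)"] P1 by (auto simp: less_Suc_eq_le)
  obtain x ys where xy: "xs = x # ys" using xs(1) by (cases xs) (auto simp: P_def)
  have xW: "x \<in> W" using xs(1) xy by (simp add: P_def)
  have nb: "z \<in> set xs" if "z \<in> adj G `` {x} \<inter> W" for z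
  proof (rule ccontr)
    assume z: "z \<notin> set xs"
    have "(z, x) \<in> adj G" using that E(5) by blast
    then have "((z # xs) ! i, (z # xs) ! Suc i) \<in> adj G" if "Suc i < length (z # xs)" for i
      using that xs(1) xy by (cases i) (auto simp: P_def)
    then have "P (z # xs)" using xs(1) z that by (simp add: P_def)
    then show False using xs(2)[of "z # xs"] by simp
  qed
  have "\<exists>j. 2 \<le> j \<and> j < length xs \<and> (x, xs ! j) \<in> adj G"
  proof -
    obtain T where T: "T \<subseteq> adj G `` {x} \<inter> W" "card T = 2"
      using obtain_subset_with_card_n[OF deg[OF xW]] by blast
    then obtain p q where pq: "T = {p, q}" "p \<noteq> q" by (auto simp: card_2_iff)
    then have "p \<in> set xs" "q \<in> set xs" "(x, p) \<in> adj G" "(x, q) \<in> adj G" using nb T by auto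
    then obtain i j where ij: "xs ! i = p" "xs ! j = q" "i < length xs" "j < length xs"
      by (auto simp: in_set_conv_nth)
    have "i \<noteq> 0" "j \<noteq> 0" using ij xy E(6) \<open>(x, p) \<in> adj G\<close> \<open>(x, q) \<in> adj G\<close>
      by (metis nth_Cons_0)+
    moreover have "i \<noteq> j" using ij pq(2) by auto
    \<comment> \<open>Two distinct nonzero positions: one of them is at least 2, so the cycle closed
      there has at least three vertices.\<close>
    ultimately have "2 \<le> i \<or> 2 \<le> j" by linarith
    then show ?thesis using ij \<open>(x, p) \<in> adj G\<close> \<open>(x, q) \<in> adj G\<close> by blast
  qed
  then obtain j where j: "2 \<le> j" "j < length xs" "(x, xs ! j) \<in> adj G" by blast
  define vs where "vs = take (Suc j) xs"
  have len: "length vs = Suc j" using j by (simp add: vs_def)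
  have "vs \<noteq> []" using len by auto
  then have "last vs = xs ! j" "hd vs = x"
    using j xy len by (auto simp: last_conv_nth hd_conv_nth vs_def simp del: take_Suc_Cons)
  then have "{last vs, hd vs} \<in> edges G" using j(3) E(5) by (simp add: adj_iff insert_commute)
  moreover have "distinct vs" using xs(1) by (simp add: vs_def P_def)
  moreover have "{vs ! i, vs ! Suc i} \<in> edges G" if "Suc i < length vs" for i
    using xs(1) that len j by (simp add: vs_def P_def adj_iff)
  ultimately have "graph_cycle G vs" using len j by (simp add: graph_cycle_def)
  then show False using assms(1) by (simp add: forest_def)
qed

text \<open>In ordered pairs this is the bound of \<open>card W - 1\<close> edges; removing a leaf
  costs at most two pairs.\<close>

lemma forest_card_adj:
  assumes "forest G" "W \<subseteq> verts G" "W \<noteq> {}"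
  shows "card (adj G \<inter> W \<times> W) + 2 \<le> 2 * card W"
  using assms(2,3)
proof (induction "card W" arbitrary: W rule: less_induct)
  case less
  have sg: "simple_graph G" using assms(1) by (simp add: forest_def)
  note E = graph_relD[OF adj_graph_rel[OF sg]]
  have finW: "finite W" using less.prems(1) E(1) finite_subset by blast
  obtain v where v: "v \<in> W" "card (adj G `` {v} \<inter> W) \<le> 1"
    using forest_has_leaf[OF assms(1) less.prems] by blast
  define N where "N = adj G `` {v} \<inter> W"
  define W' where "W' = W - {v}"
  have cW: "card W = Suc (card W')" unfolding W'_def by (rule card.remove[OF finW v(1)])
  show ?case
  proof (cases "W' = {}")
    case True
    then have "W = {v}" using v(1) by (auto simp: W'_def)
    then have "adj G \<inter> W \<times> W = {}" using E(6) by auto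
    then have "card (adj G \<inter> W \<times> W) = 0" by (simp only: card.empty)
    then show ?thesis using cW by linarith
  next
    case False
    have "W' \<subseteq> verts G" using less.prems(1) by (auto simp: W'_def)
    then have IH: "card (adj G \<inter> W' \<times> W') + 2 \<le> 2 * card W'"
      using less.hyps[of W'] cW False by simp
    have finN: "finite N" using finW by (simp add: N_def)
    have "adj G \<inter> W \<times> W \<subseteq> (adj G \<inter> W' \<times> W') \<union> ({v} \<times> N \<union> N \<times> {v})"
      using E(5) by (auto simp: W'_def N_def)
    then have "card (adj G \<inter> W \<times> W) \<le> card ((adj G \<inter> W' \<times> W') \<union> ({v} \<times> N \<union> N \<times> {v}))"
      using E(2) finN by (intro card_mono) auto
    moreover have "card ((adj G \<inter> W' \<times> W') \<union> ({v} \<times> N \<union> N \<times> {v})) \<le>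
      card (adj G \<inter> W' \<times> W') + card ({v} \<times> N \<union> N \<times> {v})" by (rule card_Un_le)
    moreover have "card ({v} \<times> N \<union> N \<times> {v}) \<le> card ({v} \<times> N) + card (N \<times> {v})"
      by (rule card_Un_le)
    moreover have "card ({v} \<times> N) + card (N \<times> {v}) \<le> 2"
      using v(2) by (simp add: card_cartesian_product N_def)
    ultimately show ?thesis using IH cW by linarith
  qed
qed

lemma vertex_degree_adj:
  assumes "simple_graph G"
  shows "vertex_degree G v = card (adj G `` {v})"
proof -
  have "{e \<in> edges G. v \<in> e} = (\<lambda>w. {v, w}) ` (adj G `` {v})"
  proof (intro equalityI subsetI)
    fix e assume "e \<in> {e \<in> edges G. v \<in> e}"
    then have e: "e \<in> edges G" "v \<in> e" "card e = 2" using assms by (auto simp: simple_graph_def)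
    then obtain w where "e = {v, w}" by (metis card_2_iff insert_commute insertE singletonD)
    then show "e \<in> (\<lambda>w. {v, w}) ` (adj G `` {v})" using e(1) by (auto simp: adj_iff)
  qed (auto simp: adj_iff)
  moreover have "inj_on (\<lambda>w. {v, w}) (adj G `` {v})"
    by (auto simp: inj_on_def doubleton_eq_iff)
  ultimately show ?thesis by (simp add: vertex_degree_def card_image)
qed

text \<open>Degree sum over \<open>C\<close> and its outside neighbourhood \<open>N\<close>: it is
  at least \<open>3 * card C + card N\<close>, and at most \<open>2 * (card C + card N) - 2\<close>
  in a forest. Hence \<open>card N\<close> is at least \<open>card C + 2\<close>.\<close>

lemma forest_card_neighbours:
  assumes "forest G" "C \<subseteq> verts G" "C \<noteq> {}"
    and deg: "\<And>v. v \<in> C \<Longrightarrow> 3 \<le> vertex_degree G v"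
  shows "3 \<le> card (adj G `` C - C)"
proof -
  have sg: "simple_graph G" using assms(1) by (simp add: forest_def)
  note E = graph_relD[OF adj_graph_rel[OF sg]]
  define N where "N = adj G `` C - C"
  define R where "R = adj G \<inter> (C \<union> N) \<times> (C \<union> N)"
  have sub: "C \<union> N \<subseteq> verts G" using assms(2) E(4) unfolding N_def by blast
  have fin: "finite (C \<union> N)" using sub E(1) finite_subset by blast
  have cCN: "card (C \<union> N) = card C + card N"
    using fin by (intro card_Un_disjoint) (auto simp: N_def)
  have finR: "finite (R `` {u})" for u
    using fin by (intro finite_subset[of "R `` {u}" "C \<union> N"]) (auto simp: R_def)
  have "R `` {u} = adj G `` {u}" if "u \<in> C" for u
    using that unfolding R_def N_def by blast
  then have degC: "3 \<le> card (R `` {u})" if "u \<in> C" for u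
    using that deg[OF that] vertex_degree_adj[OF sg] by simp
  have degN: "1 \<le> card (R `` {u})" if u: "u \<in> N" for u
  proof -
    obtain c where "c \<in> C" "(c, u) \<in> adj G" using u unfolding N_def by blast
    then have "c \<in> R `` {u}" using u E(5) unfolding R_def by blast
    then have "0 < card (R `` {u})" using finR card_gt_0_iff by blast
    then show ?thesis by linarith
  qed
  have "card R = (\<Sum>u\<in>C \<union> N. card (R `` {u}))"
    by (intro card_rel_sum[OF fin]) (simp add: R_def)
  also have "\<dots> = (\<Sum>u\<in>C. card (R `` {u})) + (\<Sum>u\<in>N. card (R `` {u}))"
    using fin by (intro sum.union_disjoint) (auto simp: N_def)
  finally have "card R = (\<Sum>u\<in>C. card (R `` {u})) + (\<Sum>u\<in>N. card (R `` {u}))" .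
  moreover have "(\<Sum>u\<in>C. 3) \<le> (\<Sum>u\<in>C. card (R `` {u}))" using degC by (rule sum_mono)
  moreover have "(\<Sum>u\<in>N. 1) \<le> (\<Sum>u\<in>N. card (R `` {u}))" using degN by (rule sum_mono)
  moreover have "card R + 2 \<le> 2 * card (C \<union> N)"
    unfolding R_def using forest_card_adj[OF assms(1) sub] assms(3) by blast
  moreover have "card C > 0" using assms(3) fin by (simp add: card_gt_0_iff)
  ultimately show ?thesis unfolding cCN N_def[symmetric] by simp
qed

lemma tree_imp_forest: "tree G \<Longrightarrow> forest G"
  by (simp add: tree_def forest_def)

text \<open>\<open>d\<close> is the distance from \<open>r\<close>, and \<open>par\<close> chooses a
  neighbour one step closer to \<open>r\<close>.\<close>

lemma rooted_tree:
  assumes "tree G" "r \<in> verts G"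
  obtains d :: "'v \<Rightarrow> nat" and par :: "'v \<Rightarrow> 'v" where
    "\<And>v. v \<in> verts G \<Longrightarrow> v \<noteq> r \<Longrightarrow> par v \<in> verts G \<and> d v = Suc (d (par v))"
    "d r = 0"
    "adj G = (\<lambda>v. (v, par v)) ` (verts G - {r}) \<union> (\<lambda>v. (par v, v)) ` (verts G - {r})"
proof -
  let ?V = "verts (G :: 'v graph)"
  have sg: "simple_graph G" using assms(1) by (simp add: tree_def)
  note E = graph_relD[OF adj_graph_rel[OF sg]]
  have conn: "(r, v) \<in> (adj G)\<^sup>*" if "v \<in> ?V" for v
    using assms that unfolding tree_def graph_connected_def adj_def by blast
  define d where "d v = (LEAST k. (r, v) \<in> adj G ^^ k)" for v
  have d: "(r, v) \<in> adj G ^^ d v" if "v \<in> ?V" for v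
    unfolding d_def using rtrancl_imp_relpow[OF conn[OF that]] by (auto intro: LeastI)
  have d_le: "d v \<le> k" if "(r, v) \<in> adj G ^^ k" for v k
    unfolding d_def using that by (rule Least_le)
  have dr: "d r = 0" using d_le[of r 0] by simp
  have "\<exists>u. u \<in> ?V \<and> (v, u) \<in> adj G \<and> d v = Suc (d u)" if v: "v \<in> ?V" "v \<noteq> r" for v
  proof -
    have "d v \<noteq> 0" using d[OF v(1)] v(2) by (metis relpow_0_E)
    then obtain k where k: "d v = Suc k" using not0_implies_Suc by blast
    then obtain u where u: "(r, u) \<in> adj G ^^ k" "(u, v) \<in> adj G"
      using d[OF v(1)] by (auto elim: relpow_Suc_E)
    have "u \<in> ?V" using E(3)[OF u(2)] .
    have "d v \<le> Suc (d u)" using d_le[OF relpow_Suc_I[OF d[OF \<open>u \<in> ?V\<close>] u(2)]] .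
    moreover have "d u \<le> k" using d_le[OF u(1)] .
    ultimately show ?thesis using k \<open>u \<in> ?V\<close> E(5)[OF u(2)] by (intro exI[of _ u]) auto
  qed
  then obtain par where par: "\<And>v. v \<in> ?V \<Longrightarrow> v \<noteq> r \<Longrightarrow>
      par v \<in> ?V \<and> (v, par v) \<in> adj G \<and> d v = Suc (d (par v))"
    by metis
  define F where "F = (\<lambda>v. (v, par v)) ` (?V - {r}) \<union> (\<lambda>v. (par v, v)) ` (?V - {r})"
  have "card F = card ((\<lambda>v. (v, par v)) ` (?V - {r})) + card ((\<lambda>v. (par v, v)) ` (?V - {r}))"
    unfolding F_def
  proof (rule card_Un_disjoint)
    show "(\<lambda>v. (v, par v)) ` (?V - {r}) \<inter> (\<lambda>v. (par v, v)) ` (?V - {r}) = {}"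
    proof (rule ccontr)
      assume "\<not> ?thesis"
      then obtain v w where vw: "v \<in> ?V" "v \<noteq> r" "w \<in> ?V" "w \<noteq> r" "v = par w" "par v = w"
        by blast
      then show False using par[OF vw(1,2)] par[OF vw(3,4)] by simp
    qed
  qed (use E(1) in auto)
  also have "\<dots> = card (?V - {r}) + card (?V - {r})"
    by (intro arg_cong2[of _ _ _ _ "(+)"] card_image) (auto simp: inj_on_def)
  finally have cF: "card F = 2 * card (?V - {r})" by simp
  have cV: "card ?V = Suc (card (?V - {r}))"
    by (rule card.remove[OF E(1) assms(2)])
  have "adj G \<inter> ?V \<times> ?V = adj G" using E(3,4) by auto
  then have "card (adj G) + 2 \<le> 2 * card ?V"
    using forest_card_adj[OF tree_imp_forest[OF assms(1)] order_refl] assms(2) by auto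
  \<comment> \<open>Acyclicity enters only by counting: the parent pairs already attain the maximum
    for a forest, so there are no other edges.\<close>
  then have "card (adj G) \<le> card F" using cF cV by simp
  moreover have "F \<subseteq> adj G" using par E(5) by (auto simp: F_def)
  ultimately have "F = adj G" using E(2) by (intro card_seteq) auto
  then show ?thesis using that[of par d] par dr unfolding F_def by simp
qed

section \<open>Upper bound\<close>

text \<open>Fixing the values off \<open>verts T\<close> makes an embedding determined by its values
  on \<open>verts T\<close>, so that embeddings can be counted.\<close>

definition embeddings :: "'a graph \<Rightarrow> 'b graph \<Rightarrow> ('a \<Rightarrow> 'b) set" where
  "embeddings T G = {\<phi> \<in> extensional (verts T). inj_on \<phi> (verts T) \<and> \<phi> ` verts T \<subseteq> verts G \<and>
     (\<forall>x y. (x, y) \<in> adj T \<longrightarrow> (\<phi> x, \<phi> y) \<in> adj G)}"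

text \<open>Automorphisms of \<open>T\<close> make several embeddings yield one copy, which is
  harmless for an upper bound.\<close>

lemma copies_subset_image_embeddings:
  assumes "simple_graph T"
  shows "copies T G \<subseteq> (\<lambda>\<phi>. (\<phi> ` verts T, (\<lambda>e. \<phi> ` e) ` edges T)) ` embeddings T G"
proof
  fix K assume "K \<in> copies T G"
  then have K: "verts K \<subseteq> verts G" "edges K \<subseteq> edges G" "graph_iso T K"
    by (auto simp: copies_def subgraph_def)
  then obtain f where f: "bij_betw f (verts T) (verts K)" "edges K = (\<lambda>e. f ` e) ` edges T"
    by (auto simp: graph_iso_def)
  define \<phi> where "\<phi> = restrict f (verts T)"
  have img: "\<phi> ` e = f ` e" if "e \<subseteq> verts T" for e
    using that unfolding \<phi>_def by (intro image_cong) auto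
  have ed: "(\<lambda>e. \<phi> ` e) ` edges T = edges K"
    unfolding f(2) using assms by (intro image_cong refl img) (simp add: simple_graph_def)
  have "\<phi> ` verts T = verts K" using f(1) img[of "verts T"] by (simp add: bij_betw_def)
  moreover have "inj_on \<phi> (verts T)"
    unfolding \<phi>_def using f(1) by (simp add: bij_betw_def)
  moreover have "(\<phi> x, \<phi> y) \<in> adj G" if "(x, y) \<in> adj T" for x y
  proof -
    have "{x, y} \<in> edges T" using that by (simp add: adj_iff)
    then have "\<phi> ` {x, y} \<in> edges K" unfolding ed[symmetric] by (rule imageI)
    then show ?thesis using K(2) by (auto simp: adj_iff)
  qed
  ultimately have "\<phi> \<in> embeddings T G"
    using K(1) unfolding embeddings_def by (auto simp: \<phi>_def)
  moreover have "K = (\<phi> ` verts T, (\<lambda>e. \<phi> ` e) ` edges T)"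
    using ed \<open>\<phi> ` verts T = verts K\<close> by (metis prod.collapse)
  ultimately show "K \<in> (\<lambda>\<phi>. (\<phi> ` verts T, (\<lambda>e. \<phi> ` e) ` edges T)) ` embeddings T G" by blast
qed

text \<open>Peeling leaves covers \<open>L\<close> by vertices and edges of the forest, one for each element of an
  independent set, and a homomorphism maps each of these to one of at most \<open>N\<close> places.\<close>

lemma forest_restrictions_card_le:
  fixes T :: "'a graph" and \<Phi> :: "('a \<Rightarrow> 'b) set"
  assumes T: "forest T" and L: "L \<subseteq> verts T"
    and U: "\<And>\<phi> x. \<phi> \<in> \<Phi> \<Longrightarrow> x \<in> verts T \<Longrightarrow> \<phi> x \<in> U" "finite U" "card U \<le> N"
    and R: "\<And>\<phi> x y. \<phi> \<in> \<Phi> \<Longrightarrow> (x, y) \<in> adj T \<Longrightarrow> (\<phi> x, \<phi> y) \<in> R" "finite R" "card R \<le> N"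
  shows "\<exists>S\<subseteq>L. independent_set T S \<and> finite ((\<lambda>\<phi>. restrict \<phi> L) ` \<Phi>) \<and>
    card ((\<lambda>\<phi>. restrict \<phi> L) ` \<Phi>) \<le> N ^ card S"
  using L
proof (induction "card L" arbitrary: L rule: less_induct)
  case less
  have sg: "simple_graph T" using T by (simp add: forest_def)
  note E = graph_relD[OF adj_graph_rel[OF sg]]
  have finL: "finite L" using less.prems E(1) finite_subset by blast
  show ?case
  proof (cases "L = {}")
    case True
    have sub: "(\<lambda>\<phi>. restrict \<phi> L) ` \<Phi> \<subseteq> {\<lambda>_. undefined}" using True by (auto simp: restrict_def)
    have "finite ((\<lambda>\<phi>. restrict \<phi> L) ` \<Phi>)" by (rule finite_subset[OF sub]) simp
    moreover have "card ((\<lambda>\<phi>. restrict \<phi> L) ` \<Phi>) \<le> 1" using card_mono[OF _ sub] by simp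
    ultimately show ?thesis by (intro exI[of _ "{}"]) (auto simp: independent_set_def)
  next
    case False
    obtain v where v: "v \<in> L" "card (adj T `` {v} \<inter> L) \<le> 1"
      using forest_has_leaf[OF T less.prems False] by blast
    have finN: "finite (adj T `` {v} \<inter> L)" using finL by simp
    \<comment> \<open>One argument for both kinds of piece: either \<open>u\<close> is the only
      neighbour of \<open>v\<close> in \<open>L\<close> and \<open>A\<close> is the edge relation of
      the host, or \<open>u = v\<close> and \<open>A\<close> is the diagonal of \<open>U\<close>. In
      both cases the piece costs one factor \<open>N\<close>.\<close>
    have step: ?thesis
      if u: "adj T `` {v} \<inter> L \<subseteq> {u}" "u \<in> L" and A: "finite A" "card A \<le> N"
        and \<Phi>A: "\<And>\<phi>. \<phi> \<in> \<Phi> \<Longrightarrow> (\<phi> v, \<phi> u) \<in> A" for u and A :: "('b \<times> 'b) set"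
    proof -
      define L' where "L' = L - {v, u}"
      have L': "L' \<subseteq> L" "v \<notin> L'" by (auto simp: L'_def)
      have "card L' < card L" using v(1) finL by (intro psubset_card_mono) (auto simp: L'_def)
      then obtain S where S: "S \<subseteq> L'" "independent_set T S" "finite ((\<lambda>\<phi>. restrict \<phi> L') ` \<Phi>)"
        "card ((\<lambda>\<phi>. restrict \<phi> L') ` \<Phi>) \<le> N ^ card S"
        using less.hyps[of L'] less.prems L'(1) by (meson order_trans)
      define g where "g = (\<lambda>((a :: 'b, b :: 'b), h :: 'a \<Rightarrow> 'b) x. if x = v then a else if x = u then b else h x)"
      let ?I = "(\<lambda>\<phi>. restrict \<phi> L') ` \<Phi>"
      have "restrict \<phi> L = g ((\<phi> v, \<phi> u), restrict \<phi> L')" for \<phi> :: "'a \<Rightarrow> 'b"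
        using v(1) u(2) by (auto simp: g_def L'_def restrict_def fun_eq_iff)
      then have sub: "(\<lambda>\<phi>. restrict \<phi> L) ` \<Phi> \<subseteq> g ` (A \<times> ?I)"
        using \<Phi>A by (intro image_subsetI) auto
      have fin: "finite (A \<times> ?I)" using A(1) S(3) by blast
      have "card ((\<lambda>\<phi>. restrict \<phi> L) ` \<Phi>) \<le> card (A \<times> ?I)"
        using card_mono[OF finite_imageI[OF fin] sub] card_image_le[OF fin, of g] by linarith
      also have "\<dots> \<le> N * N ^ card S"
        unfolding card_cartesian_product using A(2) S(4) by (rule mult_le_mono)
      also have "\<dots> = N ^ card (insert v S)"
        using S(1) L' finL finite_subset[of S L] by (subst card_insert_disjoint) auto
      finally have "card ((\<lambda>\<phi>. restrict \<phi> L) ` \<Phi>) \<le> N ^ card (insert v S)" .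
      \<comment> \<open>The only possible neighbour of \<open>v\<close> within \<open>L\<close> is
        \<open>u\<close>, and \<open>u\<close> has been removed from \<open>L'\<close>, which
        contains \<open>S\<close>.\<close>
      moreover have "independent_set T (insert v S)"
      proof -
        have vS: "(v, x) \<notin> adj T" if "x \<in> S" for x
          using that S(1) u(1) unfolding L'_def by blast
        have "(x, y) \<notin> adj T" if xy: "x \<in> insert v S" "y \<in> insert v S" for x y
        proof -
          consider "x = v" "y = v" | "x = v" "y \<in> S" | "x \<in> S" "y = v" | "x \<in> S" "y \<in> S"
            using xy by blast
          then show ?thesis
          proof cases
            case 3
            then show ?thesis using vS E(5) by blast
          next
            case 4
            then show ?thesis using S(2) by (simp add: independent_set_def adj_iff)
          qed (use vS E(6) in simp_all)
        qed
        then show ?thesis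
          using S(2) v(1) less.prems by (auto simp: independent_set_def adj_iff)
      qed
      moreover have "insert v S \<subseteq> L" using v(1) S(1) L'(1) by blast
      moreover have "finite ((\<lambda>\<phi>. restrict \<phi> L) ` \<Phi>)"
        using finite_subset[OF sub finite_imageI[OF fin]] .
      ultimately show ?thesis by blast
    qed
    show ?thesis
    proof (cases "adj T `` {v} \<inter> L = {}")
      case True
      show ?thesis
      proof (rule step[of v "(\<lambda>a. (a, a)) ` U"])
        show "card ((\<lambda>a. (a, a)) ` U) \<le> N" using card_image_le[OF U(2)] U(3) order_trans by blast
        show "(\<phi> v, \<phi> v) \<in> (\<lambda>a. (a, a)) ` U" if "\<phi> \<in> \<Phi>" for \<phi>
          using U(1)[OF that] v(1) less.prems by blast
      qed (use True v(1) U(2) in auto)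
    next
      case False
      then obtain u where u: "u \<in> adj T `` {v} \<inter> L" by blast
      then have "adj T `` {v} \<inter> L \<subseteq> {u}"
        using v(2) finN by (metis card_le_Suc0_iff_eq One_nat_def singletonI subsetI singleton_iff)
      then show ?thesis
        using u R by (intro step[of u R]) auto
    qed
  qed
qed

text \<open>\<open>Q\<close> is the kernel. The petals are disjoint as whole images, not merely
  pointwise different, because they will contain disjoint branch sets.\<close>

definition sunflower3 :: "'a set \<Rightarrow> 'a set \<Rightarrow> (nat \<Rightarrow> 'a \<Rightarrow> 'b) \<Rightarrow> bool" where
  "sunflower3 D Q f \<longleftrightarrow> (\<forall>i<3. \<forall>j<3. i \<noteq> j \<longrightarrow>
     (\<forall>x\<in>Q. f i x = f j x) \<and> f i ` (D - Q) \<inter> f j ` (D - Q) = {})"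

text \<open>Induction on the number of points outside \<open>Q\<close>. Without three disjoint
  petals a small set \<open>W\<close> meets the image of every map, so each map takes a value from
  \<open>W\<close> at some free point. Fixing that point and value leaves one free point
  fewer.\<close>

lemma sunflower_bound:
  fixes D :: "'a set"
  assumes "finite D"
  shows "\<exists>K::nat. \<forall>(\<Phi> :: ('a \<Rightarrow> 'b) set) Q. Q \<subseteq> D \<longrightarrow> card (D - Q) = k \<longrightarrow>
    (\<forall>\<phi>\<in>\<Phi>. \<forall>\<psi>\<in>\<Phi>. \<forall>x\<in>Q. \<phi> x = \<psi> x) \<longrightarrow>
    (\<forall>\<phi>\<in>\<Phi>. \<forall>\<psi>\<in>\<Phi>. (\<forall>x\<in>D. \<phi> x = \<psi> x) \<longrightarrow> \<phi> = \<psi>) \<longrightarrow>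
    (\<forall>Q' f. Q' \<subset> D \<longrightarrow> (\<forall>i<3. f i \<in> \<Phi>) \<longrightarrow> \<not> sunflower3 D Q' f) \<longrightarrow>
    finite \<Phi> \<and> card \<Phi> \<le> K"
proof (induction k)
  case 0
  show ?case
  proof (intro exI[of _ "1::nat"] allI impI)
    fix \<Phi> :: "('a \<Rightarrow> 'b) set" and Q
    assume Q: "Q \<subseteq> D" "card (D - Q) = 0" and ag: "\<forall>\<phi>\<in>\<Phi>. \<forall>\<psi>\<in>\<Phi>. \<forall>x\<in>Q. \<phi> x = \<psi> x"
      and det: "\<forall>\<phi>\<in>\<Phi>. \<forall>\<psi>\<in>\<Phi>. (\<forall>x\<in>D. \<phi> x = \<psi> x) \<longrightarrow> \<phi> = \<psi>"
    have "D = Q" using Q assms by auto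
    then have eq: "\<phi> = \<psi>" if "\<phi> \<in> \<Phi>" "\<psi> \<in> \<Phi>" for \<phi> \<psi> using that ag det by blast
    show "finite \<Phi> \<and> card \<Phi> \<le> 1"
    proof (cases "\<Phi> = {}")
      case False
      then obtain \<phi> where "\<phi> \<in> \<Phi>" by blast
      then have "\<Phi> = {\<phi>}" using eq by blast
      then show ?thesis by simp
    qed simp
  qed
next
  case (Suc k)
  then obtain K :: nat where K: "\<And>(\<Phi> :: ('a \<Rightarrow> 'b) set) Q. Q \<subseteq> D \<Longrightarrow> card (D - Q) = k \<Longrightarrow>
    (\<forall>\<phi>\<in>\<Phi>. \<forall>\<psi>\<in>\<Phi>. \<forall>x\<in>Q. \<phi> x = \<psi> x) \<Longrightarrow>
    (\<forall>\<phi>\<in>\<Phi>. \<forall>\<psi>\<in>\<Phi>. (\<forall>x\<in>D. \<phi> x = \<psi> x) \<longrightarrow> \<phi> = \<psi>) \<Longrightarrow>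
    (\<forall>Q' f. Q' \<subset> D \<longrightarrow> (\<forall>i<3. f i \<in> \<Phi>) \<longrightarrow> \<not> sunflower3 D Q' f) \<Longrightarrow>
    finite \<Phi> \<and> card \<Phi> \<le> K" by blast
  show ?case
  \<comment> \<open>\<open>Suc k\<close> choices of the point, at most \<open>2 * Suc k\<close>
    choices of the value in \<open>W\<close>, and \<open>K\<close> maps for each choice.\<close>
  proof (intro exI[of _ "Suc k * (2 * Suc k) * K"] allI impI)
    fix \<Phi> :: "('a \<Rightarrow> 'b) set" and Q
    assume Q: "Q \<subseteq> D" "card (D - Q) = Suc k" and ag: "\<forall>\<phi>\<in>\<Phi>. \<forall>\<psi>\<in>\<Phi>. \<forall>x\<in>Q. \<phi> x = \<psi> x"
      and det: "\<forall>\<phi>\<in>\<Phi>. \<forall>\<psi>\<in>\<Phi>. (\<forall>x\<in>D. \<phi> x = \<psi> x) \<longrightarrow> \<phi> = \<psi>"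
      and ns: "\<forall>Q' f. Q' \<subset> D \<longrightarrow> (\<forall>i<3. f i \<in> \<Phi>) \<longrightarrow> \<not> sunflower3 D Q' f"
    define M where "M = D - Q"
    have M: "finite M" "card M = Suc k" using assms Q by (auto simp: M_def)
    \<comment> \<open>If no such set existed, three maps with pairwise disjoint images on
      \<open>M\<close> could be picked greedily; the first two images together have at most
      \<open>2 * Suc k\<close> elements.\<close>
    have ex: "\<exists>W. finite W \<and> card W \<le> 2 * Suc k \<and> (\<forall>\<phi>\<in>\<Phi>. \<phi> ` M \<inter> W \<noteq> {})"
    proof (rule ccontr)
      assume no: "\<not> ?thesis"
      have c: "card (\<phi> ` M) \<le> Suc k" for \<phi> :: "'a \<Rightarrow> 'b" using card_image_le[OF M(1), of \<phi>] M(2) by simp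
      have *: "\<exists>\<phi>\<in>\<Phi>. \<phi> ` M \<inter> W = {}" if "finite W" "card W \<le> 2 * Suc k" for W
        using no that by blast
      obtain \<phi>1 where 1: "\<phi>1 \<in> \<Phi>" using *[of "{}"] by auto
      have "card (\<phi>1 ` M) \<le> 2 * Suc k" using c[of \<phi>1] by simp
      then obtain \<phi>2 where 2: "\<phi>2 \<in> \<Phi>" "\<phi>2 ` M \<inter> \<phi>1 ` M = {}" using *[of "\<phi>1 ` M"] M(1) by blast
      have "card (\<phi>1 ` M \<union> \<phi>2 ` M) \<le> 2 * Suc k"
        using order_trans[OF card_Un_le add_mono[OF c[of \<phi>1] c[of \<phi>2]]] by simp
      then obtain \<phi>3 where 3: "\<phi>3 \<in> \<Phi>" "\<phi>3 ` M \<inter> (\<phi>1 ` M \<union> \<phi>2 ` M) = {}"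
        using *[of "\<phi>1 ` M \<union> \<phi>2 ` M"] M(1) by blast
      define f where "f i = (if i = 0 then \<phi>1 else if i = Suc 0 then \<phi>2 else \<phi>3)" for i :: nat
      have f\<Phi>: "f i \<in> \<Phi>" for i using 1 2(1) 3(1) by (simp add: f_def)
      have lt: "i = 0 \<or> i = Suc 0 \<or> i = 2" if "i < 3" for i :: nat using that by auto
      have dis: "f i ` M \<inter> f j ` M = {}" if "i < 3" "j < 3" "i \<noteq> j" for i j
        using lt[OF that(1)] lt[OF that(2)] that(3) 2(2) 3(2) by (auto simp: f_def)
      have "sunflower3 D Q f"
        unfolding sunflower3_def using ag f\<Phi> dis unfolding M_def by blast
      moreover have "Q \<subset> D" using Q by auto
      ultimately show False using ns f\<Phi> by blast
    qed
    then obtain W where W: "finite W" "card W \<le> 2 * Suc k" "\<And>\<phi>. \<phi> \<in> \<Phi> \<Longrightarrow> \<phi> ` M \<inter> W \<noteq> {}" by blast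
    define \<Psi> where "\<Psi> p = {\<phi> \<in> \<Phi>. \<phi> (fst p) = snd p}" for p
    have \<Psi>: "finite (\<Psi> p) \<and> card (\<Psi> p) \<le> K" if p: "p \<in> M \<times> W" for p
    proof (rule K[of "insert (fst p) Q"])
      have fp: "fst p \<in> M" using p by auto
      then show "insert (fst p) Q \<subseteq> D" using Q(1) by (auto simp: M_def)
      have "D - insert (fst p) Q = M - {fst p}" by (auto simp: M_def)
      then show "card (D - insert (fst p) Q) = k" using fp M by simp
      show "\<forall>\<phi>\<in>\<Psi> p. \<forall>\<psi>\<in>\<Psi> p. \<forall>x\<in>insert (fst p) Q. \<phi> x = \<psi> x" using ag by (auto simp: \<Psi>_def)
      show "\<forall>\<phi>\<in>\<Psi> p. \<forall>\<psi>\<in>\<Psi> p. (\<forall>x\<in>D. \<phi> x = \<psi> x) \<longrightarrow> \<phi> = \<psi>"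
        using det unfolding \<Psi>_def by blast
      show "\<forall>Q' f. Q' \<subset> D \<longrightarrow> (\<forall>i<3. f i \<in> \<Psi> p) \<longrightarrow> \<not> sunflower3 D Q' f"
        using ns unfolding \<Psi>_def by blast
    qed
    have cov: "\<Phi> \<subseteq> (\<Union>p\<in>M \<times> W. \<Psi> p)"
    proof
      fix \<phi> assume \<phi>: "\<phi> \<in> \<Phi>"
      then obtain x where "x \<in> M" "\<phi> x \<in> W" using W(3) by blast
      then have "(x, \<phi> x) \<in> M \<times> W" "\<phi> \<in> \<Psi> (x, \<phi> x)" using \<phi> by (auto simp: \<Psi>_def)
      then show "\<phi> \<in> (\<Union>p\<in>M \<times> W. \<Psi> p)" by blast
    qed
    have fMW: "finite (M \<times> W)" using M W by blast
    have finU: "finite (\<Union>p\<in>M \<times> W. \<Psi> p)" using fMW \<Psi> by (intro finite_UN_I) blast+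
    have "card \<Phi> \<le> card (\<Union>p\<in>M \<times> W. \<Psi> p)" using card_mono[OF finU cov] .
    also have "\<dots> \<le> (\<Sum>p\<in>M \<times> W. card (\<Psi> p))" using fMW by (rule card_UN_le)
    also have "\<dots> \<le> (\<Sum>p\<in>M \<times> W. K)" using \<Psi> by (intro sum_mono) blast
    also have "\<dots> = card M * card W * K" by (simp add: card_cartesian_product)
    also have "\<dots> \<le> Suc k * (2 * Suc k) * K"
      using M(2) W(2) by (intro mult_le_mono) auto
    finally show "finite \<Phi> \<and> card \<Phi> \<le> Suc k * (2 * Suc k) * K"
      using finite_subset[OF cov finU] by blast
  qed
qed

lemma connected_in_image:
  assumes "connected_in E C" "\<And>x y. x \<in> C \<Longrightarrow> y \<in> C \<Longrightarrow> (x, y) \<in> E \<Longrightarrow> (f x, f y) \<in> F"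
  shows "connected_in F (f ` C)"
proof -
  have "(f u, f v) \<in> (F \<inter> f ` C \<times> f ` C)\<^sup>*" if "(u, v) \<in> (E \<inter> C \<times> C)\<^sup>*" for u v
    using that
  proof induction
    case (step y z)
    then have "(f y, f z) \<in> F \<inter> f ` C \<times> f ` C" using assms(2) by blast
    then show ?case using step.IH by (rule rtrancl_into_rtrancl[rotated])
  qed simp
  then show ?thesis using assms(1) unfolding connected_in_def by blast
qed

text \<open>A component of the petals of a sunflower has three outside neighbours, all of them in the
  kernel or in \<open>verts T - D\<close>, which the petals join in a \<open>K\<^bsub>3,3\<^esub>\<close> minor.\<close>

lemma no_sunflower_of_embeddings:
  assumes T: "forest T" and G: "planar G"
    and D: "D \<subseteq> verts T" "\<And>v. v \<in> D \<Longrightarrow> 3 \<le> vertex_degree T v"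
    and f: "\<And>i. i < 3 \<Longrightarrow> f i \<in> embeddings T G"
    and ag: "\<And>i j x. i < 3 \<Longrightarrow> j < 3 \<Longrightarrow> x \<in> verts T - D \<Longrightarrow> f i x = f j x"
    and Q: "Q \<subset> D"
  shows "\<not> sunflower3 D Q f"
proof
  assume sf: "sunflower3 D Q f"
  have sgT: "simple_graph T" using T by (simp add: forest_def)
  note E = graph_relD[OF adj_graph_rel[OF sgT]]
  have sgG: "simple_graph G" using G by (simp add: planar_def)
  note EG = graph_relD[OF adj_graph_rel[OF sgG]]
  have f': "inj_on (f i) (verts T)" "f i ` verts T \<subseteq> verts G"
    "\<And>x y. (x, y) \<in> adj T \<Longrightarrow> (f i x, f i y) \<in> adj G" if "i < 3" for i
    using f[OF that] by (auto simp: embeddings_def)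
  obtain v where v: "v \<in> D - Q" using Q by blast
  define R where "R = adj T \<inter> (D - Q) \<times> (D - Q)"
  \<comment> \<open>The component of \<open>v\<close> in the subgraph of \<open>T\<close> induced by
    \<open>D - Q\<close>; an outside neighbour of it cannot lie in \<open>D - Q\<close>.\<close>
  define C where "C = {w. (v, w) \<in> R\<^sup>*}"
  have vC: "v \<in> C" by (simp add: C_def)
  have Csub: "C \<subseteq> D - Q"
  proof
    fix w assume "w \<in> C"
    then have "(v, w) \<in> R\<^sup>*" by (simp add: C_def)
    then show "w \<in> D - Q" using v by (induction) (auto simp: R_def)
  qed
  have CT: "C \<subseteq> verts T" using Csub D(1) by blast
  have conC: "connected_in (adj T) C"
  proof (rule connected_inI[OF _ vC])
    show "sym (adj T)" using E(5) by (auto simp: sym_def)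
    fix w assume "w \<in> C"
    then have "(v, w) \<in> R\<^sup>*" by (simp add: C_def)
    then show "(v, w) \<in> (adj T \<inter> C \<times> C)\<^sup>*"
    proof induction
      case (step y z)
      then have "y \<in> C" "z \<in> C" by (auto simp: C_def)
      then have "(y, z) \<in> adj T \<inter> C \<times> C" using step by (auto simp: R_def)
      then show ?case using step.IH by (rule rtrancl_into_rtrancl[rotated])
    qed simp
  qed
  have c3: "3 \<le> card (adj T `` C - C)"
    using vC D(2) Csub by (intro forest_card_neighbours[OF T CT]) blast+
  obtain N where N: "N \<subseteq> adj T `` C - C" "card N = 3"
    using obtain_subset_with_card_n[OF c3] by blast
  have NT: "N \<subseteq> verts T" using N(1) E(4) by blast
  have Nker: "x \<in> Q \<or> x \<in> verts T - D" if x: "x \<in> N" for x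
  proof (rule ccontr)
    assume "\<not> ?thesis"
    then have xD: "x \<in> D - Q" using x NT by blast
    obtain c where c: "c \<in> C" "(c, x) \<in> adj T" using x N(1) by blast
    then have "(c, x) \<in> R" using xD Csub by (auto simp: R_def)
    then have "x \<in> C" using c(1) unfolding C_def by (auto intro: rtrancl_into_rtrancl)
    then show False using x N(1) by blast
  qed
  have agN: "f i x = f 0 x" if "i < 3" "x \<in> N" for i x
  proof (cases "i = 0")
    case False
    then show ?thesis
      using Nker[OF that(2)] ag[OF that(1), of 0 x] sf that(1) unfolding sunflower3_def by auto
  qed simp
  let ?B = "f 0 ` N" and ?A = "\<lambda>i. f i ` C"
  have fN: "f i ` N = ?B" if "i < 3" for i using agN[OF that] by (intro image_cong) auto
  have "K3_model (adj G) ?B ?A"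
    unfolding K3_model_def
  proof (intro conjI allI impI ballI)
    fix i :: nat assume i: "i < 3"
    show "connected_in (adj G) (?A i)"
      using conC f'(3)[OF i] by (rule connected_in_image)
    have "f i ` C \<inter> f i ` N = f i ` (C \<inter> N)"
      using inj_on_image_Int[OF f'(1)[OF i] CT NT] by simp
    moreover have "C \<inter> N = {}" using N(1) by blast
    ultimately show "?A i \<inter> ?B = {}" using fN[OF i] by simp
    show "\<exists>a\<in>?A i. (b, a) \<in> adj G" if b: "b \<in> ?B" for b
    proof -
      obtain x where x: "x \<in> N" "b = f i x" using b fN[OF i] by blast
      then obtain c where "c \<in> C" "(c, x) \<in> adj T" using N(1) by blast
      then show ?thesis using f'(3)[OF i] EG(5) x(2) by blast
    qed
    show "?A i \<inter> ?A j = {}" if "j < 3" "i \<noteq> j" for j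
    proof -
      have "f i ` (D - Q) \<inter> f j ` (D - Q) = {}" using sf i that unfolding sunflower3_def by blast
      then show ?thesis using Csub by blast
    qed
  qed
  moreover have "?B \<subseteq> verts G" using f'(2)[of 0] NT by auto
  moreover have "card ?B = 3"
    using card_image[OF inj_on_subset[OF f'(1)[of 0] NT]] N(2) by simp
  moreover have "?A i \<subseteq> verts G" if "i < 3" for i using f'(2)[OF that] CT by blast
  ultimately show False using planar_no_K3_model[OF G, of ?A ?B] by blast
qed

text \<open>Embeddings are sorted by their restriction to the vertices of degree at most 2.
  \<open>forest_restrictions_card_le\<close> bounds the number of classes,
  \<open>sunflower_bound\<close> the size of each; \<open>K\<close> is fixed before \<open>G\<close>
  and depends on \<open>T\<close> alone.\<close>

lemma card_copies_upper:
  fixes T :: "'a graph"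
  assumes T: "tree T"
  shows "\<exists>K::nat. \<forall>G :: nat graph. planar G \<longrightarrow> verts G \<noteq> {} \<longrightarrow>
    card (copies T G) \<le> K * (12 * card (verts G)) ^ beta T"
proof -
  have fT: "forest T" using tree_imp_forest[OF T] .
  have sgT: "simple_graph T" using fT by (simp add: forest_def)
  define L where "L = {v \<in> verts T. vertex_degree T v \<le> 2}"
  define D where "D = verts T - L"
  have finD: "finite D" using sgT by (simp add: D_def simple_graph_def)
  have degD: "3 \<le> vertex_degree T v" if "v \<in> D" for v using that by (auto simp: D_def L_def)
  obtain K :: nat where K: "\<And>(\<Phi> :: ('a \<Rightarrow> nat) set) Q. Q \<subseteq> D \<Longrightarrow> card (D - Q) = card D \<Longrightarrow>
    (\<forall>\<phi>\<in>\<Phi>. \<forall>\<psi>\<in>\<Phi>. \<forall>x\<in>Q. \<phi> x = \<psi> x) \<Longrightarrow>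
    (\<forall>\<phi>\<in>\<Phi>. \<forall>\<psi>\<in>\<Phi>. (\<forall>x\<in>D. \<phi> x = \<psi> x) \<longrightarrow> \<phi> = \<psi>) \<Longrightarrow>
    (\<forall>Q' f. Q' \<subset> D \<longrightarrow> (\<forall>i<3. f i \<in> \<Phi>) \<longrightarrow> \<not> sunflower3 D Q' f) \<Longrightarrow>
    finite \<Phi> \<and> card \<Phi> \<le> K" using sunflower_bound[OF finD, of "card D"] by blast
  show ?thesis
  proof (intro exI[of _ K] allI impI)
    fix G :: "nat graph" assume G: "planar G" and ne: "verts G \<noteq> {}"
    have sgG: "simple_graph G" using G by (simp add: planar_def)
    note EG = graph_relD[OF adj_graph_rel[OF sgG]]
    \<comment> \<open>Large enough for both the vertices and the ordered adjacent pairs of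
      \<open>G\<close>.\<close>
    define N where "N = 12 * card (verts G)"
    have N1: "1 \<le> N" using ne EG(1) by (simp add: N_def Suc_le_eq card_gt_0_iff)
    let ?Emb = "embeddings T G" and ?r = "\<lambda>\<phi>. restrict \<phi> L"
    have "\<exists>S\<subseteq>L. independent_set T S \<and> finite (?r ` ?Emb) \<and> card (?r ` ?Emb) \<le> N ^ card S"
    proof (rule forest_restrictions_card_le[OF fT])
      show "finite (verts G)" "card (verts G) \<le> N" using EG(1) by (simp_all add: N_def)
      show "finite (adj G)" "card (adj G) \<le> N" using EG(2) planar_card_adj[OF G] by (simp_all add: N_def)
    qed (auto simp: embeddings_def L_def)
    then obtain S where S: "S \<subseteq> L" "independent_set T S" "finite (?r ` ?Emb)"
      "card (?r ` ?Emb) \<le> N ^ card S" by blast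
    have "card S \<le> beta T"
      unfolding beta_def
    proof (rule Max_ge[OF beta_set_finite_nonempty(1)[OF sgT]])
      show "card S \<in> {card S |S. independent_set T S \<and> (\<forall>v\<in>S. vertex_degree T v \<le> 2)}"
        using S(1,2) unfolding L_def by blast
    qed
    then have Nb: "N ^ card S \<le> N ^ beta T" using N1 by (intro power_increasing) auto
    define F where "F h = {\<phi> \<in> ?Emb. ?r \<phi> = h}" for h
    have F: "finite (F h) \<and> card (F h) \<le> K" for h
    proof (rule K[of "{}"])
      have L_eq: "\<phi> x = \<psi> x" if "\<phi> \<in> F h" "\<psi> \<in> F h" "x \<in> L" for \<phi> \<psi> x
        using that unfolding F_def by (metis (mono_tags, lifting) mem_Collect_eq restrict_apply')
      show "\<forall>\<phi>\<in>F h. \<forall>\<psi>\<in>F h. (\<forall>x\<in>D. \<phi> x = \<psi> x) \<longrightarrow> \<phi> = \<psi>"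
      proof (intro ballI impI)
        fix \<phi> \<psi> assume a: "\<phi> \<in> F h" "\<psi> \<in> F h" "\<forall>x\<in>D. \<phi> x = \<psi> x"
        then have ext: "\<phi> \<in> extensional (verts T)" "\<psi> \<in> extensional (verts T)"
          by (auto simp: F_def embeddings_def)
        show "\<phi> = \<psi>"
        proof (rule extensionalityI[OF ext])
          fix x assume "x \<in> verts T"
          then show "\<phi> x = \<psi> x" using L_eq[OF a(1,2)] a(3) by (cases "x \<in> L") (auto simp: D_def)
        qed
      qed
      show "\<forall>Q' f. Q' \<subset> D \<longrightarrow> (\<forall>i<3. f i \<in> F h) \<longrightarrow> \<not> sunflower3 D Q' f"
      proof (intro allI impI)
        fix Q' and f :: "nat \<Rightarrow> 'a \<Rightarrow> nat"
        assume Q': "Q' \<subset> D" and f: "\<forall>i<3. f i \<in> F h"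
        show "\<not> sunflower3 D Q' f"
        proof (rule no_sunflower_of_embeddings[OF fT G _ degD _ _ Q'])
          show "D \<subseteq> verts T" by (auto simp: D_def)
          show "f i \<in> embeddings T G" if "i < 3" for i using f that by (auto simp: F_def)
          show "f i x = f j x" if "i < 3" "j < 3" "x \<in> verts T - D" for i j x
            using f that by (intro L_eq) (auto simp: D_def)
        qed
      qed
    qed auto
    have cov: "?Emb = (\<Union>h\<in>?r ` ?Emb. F h)" by (auto simp: F_def)
    have finE: "finite ?Emb" by (subst cov) (use S(3) F in blast)
    have "card (\<Union>h\<in>?r ` ?Emb. F h) \<le> (\<Sum>h\<in>?r ` ?Emb. card (F h))"
      using S(3) by (rule card_UN_le)
    also have "\<dots> \<le> (\<Sum>h\<in>?r ` ?Emb. K)" using F by (intro sum_mono) blast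
    also have "\<dots> = card (?r ` ?Emb) * K" by simp
    also have "\<dots> \<le> N ^ beta T * K" using S(4) Nb by (intro mult_le_mono1) linarith
    finally have "card ?Emb \<le> N ^ beta T * K" unfolding cov[symmetric] .
    moreover have "card (copies T G) \<le> card ?Emb"
      using surj_card_le[OF finE copies_subset_image_embeddings[OF sgT]] .
    ultimately show "card (copies T G) \<le> K * (12 * card (verts G)) ^ beta T"
      unfolding N_def by (simp add: mult.commute)
  qed
qed

section \<open>Lower bound\<close>

text \<open>The abscissa is the vertex number itself, so distinct vertices get distinct points
  whatever the layers are.\<close>

definition layer_point :: "(nat \<Rightarrow> nat) \<Rightarrow> nat \<Rightarrow> complex" where
  "layer_point Y k = Complex (real k) (real (Y k))"

lemma layer_segment:
  assumes "z \<in> closed_segment (layer_point Y a) (layer_point Y b)" "Y b = Suc (Y a)"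
  obtains t where "0 \<le> t" "t \<le> 1" "Re z = (1 - t) * real a + t * real b" "Im z = real (Y a) + t"
proof -
  obtain t where t: "0 \<le> t" "t \<le> 1"
    "z = (1 - t) *\<^sub>R layer_point Y a + t *\<^sub>R layer_point Y b"
    using assms(1) by (auto simp: closed_segment_def)
  show ?thesis
  proof (rule that[OF t(1,2)])
    show "Re z = (1 - t) * real a + t * real b" by (simp add: t(3) layer_point_def)
    show "Im z = real (Y a) + t" by (simp add: t(3) layer_point_def assms(2) algebra_simps)
  qed
qed

text \<open>Strictly between the ends of the segment the height is not an integer.\<close>

lemma layer_point_in_segment:
  assumes "layer_point Y k \<in> closed_segment (layer_point Y a) (layer_point Y b)" "Y b = Suc (Y a)"
  shows "k = a \<or> k = b"
proof -
  obtain t where t: "0 \<le> t" "t \<le> 1" "real k = (1 - t) * real a + t * real b"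
    "real (Y k) = real (Y a) + t"
    using layer_segment[OF assms] by (auto simp: layer_point_def)
  have "Y k = Y a \<or> Y k = Suc (Y a)" using t(1,2,4) by linarith
  then have "t = 0 \<or> t = 1" using t(4) by auto
  then show ?thesis using t(3) by auto
qed

text \<open>Segments from different layers can meet only at a common height, an end of both. Within
  a layer, the horizontal distance at relative height \<open>t\<close> is a convex combination of
  the nonnegative distances at the ends and vanishes only at a shared end.\<close>

lemma layer_segments_meet:
  assumes z: "z \<in> closed_segment (layer_point Y a) (layer_point Y b)"
      "z \<in> closed_segment (layer_point Y a') (layer_point Y b')"
    and Y: "Y b = Suc (Y a)" "Y b' = Suc (Y a')" and ne: "(a, b) \<noteq> (a', b')"
    and mono: "Y a = Y a' \<Longrightarrow> a < a' \<Longrightarrow> b \<le> b'"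
    and ord: "Y a < Y a' \<or> (Y a = Y a' \<and> a \<le> a')"
  shows "z \<in> layer_point Y ` ({a, b} \<inter> {a', b'})"
proof -
  obtain t where t: "0 \<le> t" "t \<le> 1" "Re z = (1 - t) * real a + t * real b" "Im z = real (Y a) + t"
    using layer_segment[OF z(1) Y(1)] .
  obtain s where s: "0 \<le> s" "s \<le> 1" "Re z = (1 - s) * real a' + s * real b'" "Im z = real (Y a') + s"
    using layer_segment[OF z(2) Y(2)] .
  consider "Y a < Y a'" | "Y a = Y a'" "a = a'" | "Y a = Y a'" "a < a'" using ord by linarith
  then show ?thesis
  proof cases
    case 1
    then have "real (Y a) + 1 \<le> real (Y a')" by linarith
    then have "t = 1" "s = 0" using t s by linarith+
    then have "Re z = real b" "real b = real a'" "Im z = real (Y b)" using t s Y(1) by auto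
    then have "z = layer_point Y b" "b = a'" by (simp_all add: layer_point_def complex_eq_iff)
    then show ?thesis by blast
  next
    case 2
    then have "t = s" using t s by linarith
    then have "t * real b = t * real b'" using t(3) s(3) 2(2) by auto
    moreover have "b \<noteq> b'" using ne 2(2) by simp
    ultimately have "t = 0" by simp
    then have "z = layer_point Y a" using t by (simp add: layer_point_def complex_eq_iff)
    then show ?thesis using 2 by blast
  next
    case 3
    then have ts: "t = s" using t s by linarith
    have "b \<le> b'" using mono 3 by blast
    then have "t * (real b' - real b) \<ge> 0" using t(1) by simp
    moreover have "(1 - t) * (real a' - real a) \<ge> 0" using t(2) 3 by simp
    moreover have "t * (real b' - real b) + (1 - t) * (real a' - real a) = 0"
      using t(3) s(3) unfolding ts by (simp add: algebra_simps)
    ultimately have "t * (real b' - real b) = 0" "(1 - t) * (real a' - real a) = 0" by linarith+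
    then have "t = 1" "b = b'" using 3(2) by auto
    then have "z = layer_point Y b" using t Y(1) by (simp add: layer_point_def complex_eq_iff)
    then show ?thesis using \<open>b = b'\<close> by blast
  qed
qed

lemma layered_planar:
  fixes G :: "nat graph" and Y :: "nat \<Rightarrow> nat"
  assumes sg: "simple_graph G"
    and layer: "\<And>e. e \<in> edges G \<Longrightarrow> \<exists>a b. e = {a, b} \<and> Y b = Suc (Y a)"
    and mono: "\<And>a b a' b'. {a, b} \<in> edges G \<Longrightarrow> {a', b'} \<in> edges G \<Longrightarrow> Y b = Suc (Y a) \<Longrightarrow>
      Y b' = Suc (Y a') \<Longrightarrow> Y a = Y a' \<Longrightarrow> a < a' \<Longrightarrow> b \<le> b'"
  shows "planar G"
proof -
  obtain lo hi where lh: "\<And>e. e \<in> edges G \<Longrightarrow> e = {lo e, hi e}"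
    "\<And>e. e \<in> edges G \<Longrightarrow> Y (hi e) = Suc (Y (lo e))"
    using layer by metis
  let ?p = "layer_point Y"
  define \<gamma> where "\<gamma> e = linepath (?p (lo e)) (?p (hi e))" for e
  have inj: "inj ?p" by (auto simp: inj_def layer_point_def)
  have pi: "path_image (\<gamma> e) = closed_segment (?p (lo e)) (?p (hi e))" for e by (simp add: \<gamma>_def)
  have "planar_drawing G ?p \<gamma>"
    unfolding planar_drawing_def
  proof (intro conjI ballI impI)
    show "inj_on ?p (verts G)" using inj inj_on_subset by blast
    fix e assume e: "e \<in> edges G"
    have "lo e \<noteq> hi e" using lh(2)[OF e] by auto
    then have "?p (lo e) \<noteq> ?p (hi e)" using inj by (auto dest: injD)
    then show "arc (\<gamma> e)" by (simp add: \<gamma>_def arc_linepath)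
    have pe: "?p ` e = {?p (lo e), ?p (hi e)}" using lh(1)[OF e] by (metis image_empty image_insert)
    then show "{pathstart (\<gamma> e), pathfinish (\<gamma> e)} = ?p ` e" by (simp add: \<gamma>_def)
    show "path_image (\<gamma> e) \<inter> ?p ` verts G = ?p ` e"
    proof
      show "path_image (\<gamma> e) \<inter> ?p ` verts G \<subseteq> ?p ` e"
      proof
        fix z assume "z \<in> path_image (\<gamma> e) \<inter> ?p ` verts G"
        then obtain k where k: "z = ?p k" "?p k \<in> closed_segment (?p (lo e)) (?p (hi e))"
          unfolding pi by blast
        then show "z \<in> ?p ` e" using layer_point_in_segment[OF k(2) lh(2)[OF e]] unfolding pe by blast
      qed
      have "e \<subseteq> verts G" using sg e by (simp add: simple_graph_def)
      moreover have "?p ` e \<subseteq> path_image (\<gamma> e)" unfolding pe pi by simp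
      ultimately show "?p ` e \<subseteq> path_image (\<gamma> e) \<inter> ?p ` verts G" by blast
    qed
    fix e' assume e': "e' \<in> edges G" and ne: "e \<noteq> e'"
    have ne2: "(lo e, hi e) \<noteq> (lo e', hi e')" using lh(1)[OF e] lh(1)[OF e'] ne by auto
    have m1: "Y (lo e) = Y (lo e') \<Longrightarrow> lo e < lo e' \<Longrightarrow> hi e \<le> hi e'"
      using mono[of "lo e" "hi e" "lo e'" "hi e'"] lh e e' by metis
    have m2: "Y (lo e') = Y (lo e) \<Longrightarrow> lo e' < lo e \<Longrightarrow> hi e' \<le> hi e"
      using mono[of "lo e'" "hi e'" "lo e" "hi e"] lh e e' by metis
    show "path_image (\<gamma> e) \<inter> path_image (\<gamma> e') \<subseteq> ?p ` (e \<inter> e')"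
    proof
      fix z assume "z \<in> path_image (\<gamma> e) \<inter> path_image (\<gamma> e')"
      then have z: "z \<in> closed_segment (?p (lo e)) (?p (hi e))"
        "z \<in> closed_segment (?p (lo e')) (?p (hi e'))" unfolding pi by blast+
      have "z \<in> ?p ` ({lo e, hi e} \<inter> {lo e', hi e'})"
      proof (cases "Y (lo e) < Y (lo e') \<or> (Y (lo e) = Y (lo e') \<and> lo e \<le> lo e')")
        case True
        then show ?thesis using layer_segments_meet[OF z lh(2)[OF e] lh(2)[OF e'] ne2 m1] by blast
      next
        case False
        then have "Y (lo e') < Y (lo e) \<or> (Y (lo e') = Y (lo e) \<and> lo e' \<le> lo e)" by linarith
        then have "z \<in> ?p ` ({lo e', hi e'} \<inter> {lo e, hi e})"
          using layer_segments_meet[OF z(2,1) lh(2)[OF e'] lh(2)[OF e] ne2[symmetric] m2] by blast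
        then show ?thesis by (simp add: Int_commute)
      qed
      then show "z \<in> ?p ` (e \<inter> e')" using lh(1)[OF e] lh(1)[OF e'] by metis
    qed
  qed
  then show ?thesis using sg by (auto simp: planar_def)
qed

text \<open>The labels of a vertex and its ancestors are read as digits in base \<open>N\<close>,
  the root's label leading. The order of the parents then decides, and the last digit identifies the
  vertex.\<close>

lemma breadth_first_order:
  fixes d :: "'v \<Rightarrow> nat" and par :: "'v \<Rightarrow> 'v"
  assumes "finite V"
    and par: "\<And>v. v \<in> V \<Longrightarrow> v \<noteq> r \<Longrightarrow> par v \<in> V \<and> d v = Suc (d (par v))"
    and dr: "d r = 0"
  shows "\<exists>x :: 'v \<Rightarrow> nat. inj_on x V \<and>
    (\<forall>u\<in>V - {r}. \<forall>v\<in>V - {r}. x (par u) < x (par v) \<longrightarrow> x u < x v)"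
proof -
  obtain \<iota> where \<iota>: "bij_betw \<iota> V {0..<card V}" using ex_bij_betw_finite_nat[OF assms(1)] by blast
  define N where "N = card V"
  have \<iota>N: "\<iota> v < N" if "v \<in> V" for v using \<iota> that by (auto simp: bij_betw_def N_def)
  define x where "x v = (\<Sum>i\<le>d v. \<iota> ((par ^^ i) v) * N ^ i)" for v
  have xr: "x r = \<iota> r" by (simp add: x_def dr)
  have xs: "x v = \<iota> v + N * x (par v)" if "v \<in> V" "v \<noteq> r" for v
  proof -
    have "d v = Suc (d (par v))" using par that by blast
    then have "x v = \<iota> v + (\<Sum>i\<le>d (par v). \<iota> ((par ^^ Suc i) v) * N ^ Suc i)"
      unfolding x_def by (simp only: sum.atMost_Suc_shift) simp
    also have "(\<Sum>i\<le>d (par v). \<iota> ((par ^^ Suc i) v) * N ^ Suc i) = N * x (par v)"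
      unfolding x_def sum_distrib_left
      by (intro sum.cong refl) (simp add: funpow_swap1 mult.left_commute)
    finally show ?thesis .
  qed
  have xmod: "x v mod N = \<iota> v" if "v \<in> V" for v
    using xs[OF that] xr \<iota>N[OF that] by (cases "v = r") auto
  show ?thesis
  proof (intro exI[of _ x] conjI ballI impI)
    show "inj_on x V"
    proof (rule inj_onI)
      fix u v assume uv: "u \<in> V" "v \<in> V" "x u = x v"
      then have "\<iota> u = \<iota> v" using xmod[OF uv(1)] xmod[OF uv(2)] by simp
      then show "u = v" using \<iota> uv by (auto simp: bij_betw_def inj_on_def)
    qed
    fix u v assume "u \<in> V - {r}" "v \<in> V - {r}" and less: "x (par u) < x (par v)"
    then have uv: "u \<in> V" "v \<in> V" "u \<noteq> r" "v \<noteq> r" by auto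
    have "x u < N + N * x (par u)" using xs[OF uv(1,3)] \<iota>N[OF uv(1)] by simp
    also have "\<dots> = N * Suc (x (par u))" by simp
    also have "\<dots> \<le> N * x (par v)" using less by (intro mult_le_mono2) simp
    also have "\<dots> \<le> x v" using xs[OF uv(2,4)] by simp
    finally show "x u < x v" .
  qed
qed

text \<open>Twins of adjacent vertices are joined completely. No crossing arises because a vertex
  with several twins has at most one child, and that child lies outside \<open>S\<close> and has a
  single twin.\<close>

lemma blowup_lower_bound:
  fixes T :: "'a graph"
  assumes T: "tree T" and S: "independent_set T S" "\<And>v. v \<in> S \<Longrightarrow> vertex_degree T v \<le> 2"
    and m: "1 \<le> m" and n: "card (verts T) * m \<le> n"
  shows "\<exists>H :: nat graph. planar H \<and> card (verts H) = n \<and> m ^ card S \<le> card (copies T H)"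
proof -
  let ?V = "verts T"
  have sg: "simple_graph T" using T by (simp add: tree_def)
  note E = graph_relD[OF adj_graph_rel[OF sg]]
  have SV: "S \<subseteq> ?V" using S(1) by (simp add: independent_set_def)
  have finS: "finite S" using SV E(1) finite_subset by blast
  have SS: "(u, v) \<notin> adj T" if "u \<in> S" "v \<in> S" for u v
    using S(1) that by (simp add: independent_set_def adj_iff)
  \<comment> \<open>If every vertex is in \<open>S\<close>, the tree has no edges and, being
    connected, is a single vertex; otherwise the root is taken outside \<open>S\<close>.\<close>
  have "\<exists>r\<in>?V. r \<in> S \<longrightarrow> ?V = {r}"
  proof (cases "?V \<subseteq> S")
    case False
    then show ?thesis by blast
  next
    case True
    have "adj T = {}" using SS E(3,4) True by fast
    moreover obtain r where r: "r \<in> ?V" using T by (auto simp: tree_def graph_connected_def)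
    moreover have "(r, v) \<in> (adj T)\<^sup>*" if "v \<in> ?V" for v
      using T r that unfolding tree_def graph_connected_def adj_def by blast
    ultimately show ?thesis by auto
  qed
  then obtain r where r: "r \<in> ?V" "r \<in> S \<Longrightarrow> ?V = {r}" by blast
  obtain d par where par: "\<And>v. v \<in> ?V \<Longrightarrow> v \<noteq> r \<Longrightarrow> par v \<in> ?V \<and> d v = Suc (d (par v))"
    and dr: "d r = (0::nat)"
    and adjT: "adj T = (\<lambda>v. (v, par v)) ` (?V - {r}) \<union> (\<lambda>v. (par v, v)) ` (?V - {r})"
  proof (rule rooted_tree[OF T r(1)])
    fix d :: "'a \<Rightarrow> nat" and par
    assume *: "\<And>v. v \<in> ?V \<Longrightarrow> v \<noteq> r \<Longrightarrow> par v \<in> ?V \<and> d v = Suc (d (par v))" "d r = 0"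
      "adj T = (\<lambda>v. (v, par v)) ` (?V - {r}) \<union> (\<lambda>v. (par v, v)) ` (?V - {r})"
    show thesis by (rule that[OF *])
  qed
  obtain x :: "'a \<Rightarrow> nat" where x: "inj_on x ?V"
    and xmono: "\<And>u v. u \<in> ?V \<Longrightarrow> v \<in> ?V \<Longrightarrow> u \<noteq> r \<Longrightarrow> v \<noteq> r \<Longrightarrow> x (par u) < x (par v) \<Longrightarrow> x u < x v"
    using breadth_first_order[of ?V r par d, OF E(1) par dr] by blast
  define M where "M v = (if v \<in> S then m else 1)" for v
  have Mm: "M v \<le> m" for v using m by (simp add: M_def)
  \<comment> \<open>the \<open>i\<close>-th twin of \<open>v\<close>; this number is also its abscissa, and \<open>d v\<close> its ordinate\<close>
  define P where "P v i = x v * m + i" for v i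
  have Pdiv: "P v i div m = x v" if "i < M v" for v i
    using that Mm[of v] by (simp add: P_def)
  have Pless: "P u i < P v j" if "x u < x v" "i < M u" for u v i j
  proof -
    have "P u i < Suc (x u) * m" using that(2) Mm[of u] by (simp add: P_def)
    also have "\<dots> \<le> x v * m" using that(1) by (intro mult_le_mono1) simp
    also have "\<dots> \<le> P v j" by (simp add: P_def)
    finally show ?thesis .
  qed
  \<comment> \<open>Division by \<open>m\<close> recovers \<open>x v\<close> from a twin of
    \<open>v\<close>. Elsewhere the height is arbitrary, which only concerns isolated
    vertices.\<close>
  define Y where "Y k = d (inv_into ?V x (k div m))" for k
  have YP: "Y (P v i) = d v" if "v \<in> ?V" "i < M v" for v i
    using Pdiv[OF that(2)] inv_into_f_f[OF x that(1)] by (simp add: Y_def)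
  define U where "U = (\<lambda>(v, i). P v i) ` (SIGMA v:?V. {..<M v})"
  have U: "finite U" "card U \<le> n"
  proof -
    have sub: "(SIGMA v:?V. {..<M v}) \<subseteq> ?V \<times> {..<m}" using Mm by (force intro: less_le_trans)
    have fin: "finite (?V \<times> {..<m})" using E(1) by blast
    have fin2: "finite (SIGMA v:?V. {..<M v})" using finite_subset[OF sub fin] .
    then show "finite U" by (simp add: U_def)
    have "card U \<le> card (SIGMA v:?V. {..<M v})" unfolding U_def using fin2 by (rule card_image_le)
    also have "\<dots> \<le> card (?V \<times> {..<m})" using card_mono[OF fin sub] .
    also have "\<dots> \<le> n" using n by (simp add: card_cartesian_product)
    finally show "card U \<le> n" .
  qed
  \<comment> \<open>Isolated vertices \<open>Z\<close> fill the host up to exactly \<open>n\<close>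
    vertices.\<close>
  have "infinite (- U)" using U(1) by (simp add: finite_compl)
  then obtain Z where Z: "finite Z" "card Z = n - card U" "Z \<subseteq> - U"
    using infinite_arbitrarily_large by blast
  define EH where "EH = {{P v i, P (par v) j} | v i j. v \<in> ?V \<and> v \<noteq> r \<and> i < M v \<and> j < M (par v)}"
  define H where "H = (U \<union> Z, EH)"
  have PU: "P v i \<in> U" if "v \<in> ?V" "i < M v" for v i using that by (auto simp: U_def)
  have YPpar: "Y (P v i) = Suc (Y (P (par v) j))"
    if "v \<in> ?V" "v \<noteq> r" "i < M v" "j < M (par v)" for v i j
    using YP[OF that(1,3)] YP[OF _ that(4)] par[OF that(1,2)] by simp
  have cH: "card (verts H) = n"
    unfolding H_def fst_conv
    by (subst card_Un_disjoint) (use U Z in auto)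
  have sgH: "simple_graph H"
    unfolding simple_graph_def
  proof (intro conjI ballI)
    show "finite (verts H)" using U(1) Z(1) by (simp add: H_def)
    fix e assume "e \<in> edges H"
    then obtain v i j where v: "v \<in> ?V" "v \<noteq> r" "i < M v" "j < M (par v)" "e = {P v i, P (par v) j}"
      by (auto simp: H_def EH_def)
    have "P v i \<noteq> P (par v) j" using YPpar[OF v(1-4)] by auto
    then show "card e = 2" using v(5) by simp
    show "e \<subseteq> verts H"
      using PU[OF v(1,3)] PU[OF _ v(4)] par[OF v(1,2)] v(5) by (simp add: H_def)
  qed
  have orient: "\<exists>v i j. v \<in> ?V \<and> v \<noteq> r \<and> i < M v \<and> j < M (par v) \<and> b = P v i \<and> a = P (par v) j"
    if ab: "{a, b} \<in> EH" "Y b = Suc (Y a)" for a b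
  proof -
    obtain v i j where v: "v \<in> ?V" "v \<noteq> r" "i < M v" "j < M (par v)" "{a, b} = {P v i, P (par v) j}"
      using ab(1) unfolding EH_def by blast
    then consider "a = P (par v) j" "b = P v i" | "a = P v i" "b = P (par v) j"
      by (auto simp: doubleton_eq_iff)
    then show ?thesis
    proof cases
      case 1
      then show ?thesis using v by blast
    next
      case 2
      then show ?thesis using YPpar[OF v(1-4)] ab(2) by simp
    qed
  qed
  \<comment> \<open>A parent in \<open>S\<close> is not the root here, so two children and its own
    parent would give it degree at least 3.\<close>
  have only_child: "v = w"
    if vw: "v \<in> ?V" "v \<noteq> r" "w \<in> ?V" "w \<noteq> r" "par v = par w" "par v \<in> S" for v w
  proof (rule ccontr)
    assume "v \<noteq> w"
    let ?p = "par v"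
    have p: "?p \<in> ?V" "d v = Suc (d ?p)" "d w = Suc (d ?p)"
      using par[OF vw(1,2)] par[OF vw(3,4)] vw(5) by auto
    have "?p \<noteq> r" using r(2) vw(1,2,6) by blast
    then have pp: "d ?p = Suc (d (par ?p))" using par[OF p(1)] by blast
    have ch: "(u, par u) \<in> adj T" "(par u, u) \<in> adj T" if "u \<in> ?V" "u \<noteq> r" for u
      using that unfolding adjT by blast+
    have "(?p, w) \<in> adj T" unfolding vw(5) by (rule ch(2)[OF vw(3,4)])
    then have sub: "{v, w, par ?p} \<subseteq> adj T `` {?p}"
      using ch(2)[OF vw(1,2)] ch(1)[OF p(1) \<open>?p \<noteq> r\<close>] by simp
    have "par ?p \<noteq> v" "par ?p \<noteq> w" using p pp by auto
    then have "card {v, w, par ?p} = 3" using \<open>v \<noteq> w\<close> by auto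
    moreover have "finite (adj T `` {?p})" using E(2) by (rule finite_Image)
    ultimately have "3 \<le> card (adj T `` {?p})" using card_mono[OF _ sub] by metis
    then show False using S(2)[OF vw(6)] vertex_degree_adj[OF sg] by simp
  qed
  have "planar H"
  proof (rule layered_planar[OF sgH, of Y])
    fix e assume "e \<in> edges H"
    then obtain v i j where v: "v \<in> ?V" "v \<noteq> r" "i < M v" "j < M (par v)" "e = {P v i, P (par v) j}"
      by (auto simp: H_def EH_def)
    then show "\<exists>a b. e = {a, b} \<and> Y b = Suc (Y a)"
      using YPpar[OF v(1-4)] by (metis insert_commute)
  next
    fix a b a' b'
    assume e: "{a, b} \<in> edges H" "{a', b'} \<in> edges H" and Yab: "Y b = Suc (Y a)" "Y b' = Suc (Y a')"
      and less: "a < a'"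
    obtain v i j where v: "v \<in> ?V" "v \<noteq> r" "i < M v" "j < M (par v)" "b = P v i" "a = P (par v) j"
      using orient[of a b] e(1) Yab(1) by (auto simp: H_def)
    obtain w k l where w: "w \<in> ?V" "w \<noteq> r" "k < M w" "l < M (par w)" "b' = P w k" "a' = P (par w) l"
      using orient[of a' b'] e(2) Yab(2) by (auto simp: H_def)
    show "b \<le> b'"
    proof (cases "par v = par w")
      case True
      \<comment> \<open>Two different twins of one parent occur, so the parent is in
        \<open>S\<close>. Its only child then has one twin, and both edges end there.\<close>
      then have "j < l" using less v(6) w(6) by (simp add: P_def)
      then have pS: "par v \<in> S" using w(4) True by (auto simp: M_def split: if_splits)
      have vw: "v = w" using only_child v(1,2) w(1,2) True pS by blast
      have "(v, par v) \<in> adj T" using v(1,2) unfolding adjT by blast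
      then have "v \<notin> S" using SS pS by blast
      then show ?thesis using v(3,5) w(3,5) vw by (simp add: M_def)
    next
      case False
      then have "x (par v) \<noteq> x (par w)"
        using x par v(1,2) w(1,2) by (meson inj_onD)
      moreover have "\<not> x (par w) < x (par v)"
        using Pless[OF _ w(4), of "par v" j] less v(6) w(6) by auto
      ultimately have "x (par v) < x (par w)" by linarith
      then have "x v < x w" using xmono v(1,2) w(1,2) by blast
      then show ?thesis using Pless[OF _ v(3), of w k] v(5) w(5) by auto
    qed
  qed
  moreover have "m ^ card S \<le> card (copies T H)"
  proof -
    define \<phi> where "\<phi> f v = P v (if v \<in> S then f v else 0)" for f v
    define C where "C f = (\<phi> f ` ?V, (\<lambda>e. \<phi> f ` e) ` edges T)" for f
    let ?F = "S \<rightarrow>\<^sub>E {..<m}"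
    have lt: "(if v \<in> S then f v else 0) < M v" if "f \<in> ?F" for f v
      using that by (auto simp: M_def PiE_def)
    have \<phi>div: "\<phi> f v div m = x v" if "f \<in> ?F" for f v
      unfolding \<phi>_def using Pdiv[OF lt[OF that]] .
    have inj\<phi>: "inj_on (\<phi> f) ?V" if "f \<in> ?F" for f
    proof (rule inj_onI)
      fix u v assume "u \<in> ?V" "v \<in> ?V" "\<phi> f u = \<phi> f v"
      then show "u = v" using \<phi>div[OF that] x by (metis inj_onD)
    qed
    have Ccop: "C f \<in> copies T H" if f: "f \<in> ?F" for f
    proof -
      have edge: "\<phi> f ` e \<in> EH" if e: "e \<in> edges T" for e
      proof -
        have "card e = 2" using sg e by (simp add: simple_graph_def)
        then obtain a b where "e = {a, b}" by (auto simp: card_2_iff)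
        then have "(a, b) \<in> adj T" using e by (simp add: adj_iff)
        then obtain v where v: "v \<in> ?V" "v \<noteq> r" "e = {v, par v}"
          using \<open>e = {a, b}\<close> unfolding adjT by (auto simp: insert_commute)
        have "\<phi> f ` e = {P v (if v \<in> S then f v else 0), P (par v) (if par v \<in> S then f (par v) else 0)}"
          by (simp add: v(3) \<phi>_def)
        then show ?thesis unfolding EH_def using v(1,2) lt[OF f] by blast
      qed
      have "\<phi> f ` ?V \<subseteq> U" unfolding \<phi>_def using PU lt[OF f] by blast
      moreover have "(\<lambda>e. \<phi> f ` e) ` edges T \<subseteq> EH" using edge by blast
      moreover have "simple_graph (C f)"
        unfolding simple_graph_def
      proof (intro conjI ballI)
        show "finite (verts (C f))" using E(1) by (simp add: C_def)
        fix e assume "e \<in> edges (C f)"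
        then obtain e0 where e0: "e0 \<in> edges T" "e = \<phi> f ` e0" by (auto simp: C_def)
        have e0V: "e0 \<subseteq> ?V" "card e0 = 2" using sg e0(1) by (auto simp: simple_graph_def)
        show "e \<subseteq> verts (C f)" using e0V(1) by (auto simp: C_def e0(2))
        show "card e = 2" using card_image[OF inj_on_subset[OF inj\<phi>[OF f] e0V(1)]] e0(2) e0V(2) by simp
      qed
      moreover have "graph_iso T (C f)"
        unfolding graph_iso_def using inj\<phi>[OF f]
        by (intro exI[of _ "\<phi> f"]) (simp add: C_def bij_betw_def)
      ultimately show ?thesis
        by (auto simp: copies_def subgraph_def H_def C_def)
    qed
    \<comment> \<open>The vertex set of the copy determines \<open>f\<close>: division by
      \<open>m\<close> tells which vertex is a twin of \<open>s\<close>, and its index is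
      \<open>f s\<close>.\<close>
    have "inj_on C ?F"
    proof (rule inj_onI)
      fix f g assume fg: "f \<in> ?F" "g \<in> ?F" "C f = C g"
      show "f = g"
      proof (rule PiE_ext[OF fg(1,2)])
        fix s assume s: "s \<in> S"
        then have "s \<in> ?V" using SV by blast
        then have "\<phi> f s \<in> \<phi> g ` ?V" using fg(3) by (auto simp: C_def)
        then obtain u where u: "u \<in> ?V" "\<phi> f s = \<phi> g u" by blast
        have "x s = x u" using \<phi>div[OF fg(1), of s] \<phi>div[OF fg(2), of u] u(2) by simp
        then have "s = u" using x u(1) \<open>s \<in> ?V\<close> by (meson inj_onD)
        then show "f s = g s" using u(2) s by (simp add: \<phi>_def P_def)
      qed
    qed
    moreover have "C ` ?F \<subseteq> copies T H" using Ccop by blast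
    ultimately have "card ?F \<le> card (copies T H)"
      using card_copies_le(1)[OF sgH] by (rule card_inj_on_le)
    then show ?thesis using finS by (simp add: card_PiE)
  qed
  ultimately show ?thesis using cH by blast
qed

section \<open>The order of magnitude\<close>

theorem theorem2p3:
  fixes T :: "'a graph"
  assumes "tree T"
  shows "(\<lambda>n. real (ex_planar n T {})) \<in> \<Theta>(\<lambda>n. real n ^ beta T)"
proof -
  have sg: "simple_graph T" using assms by (simp add: tree_def)
  have ne: "verts T \<noteq> {}" using assms by (simp add: tree_def graph_connected_def)
  let ?X = "\<lambda>n. (\<lambda>G. card (copies T G)) ` planar_hosts n {}"
  obtain K :: nat where K: "\<And>G :: nat graph. planar G \<Longrightarrow> verts G \<noteq> {} \<Longrightarrow>
      card (copies T G) \<le> K * (12 * card (verts G)) ^ beta T"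
    using card_copies_upper[OF assms] by blast
  have upper: "real (ex_planar n T {}) \<le> real (K * 12 ^ beta T) * real n ^ beta T" if n: "1 \<le> n" for n
  proof -
    have "ex_planar n T {} \<le> K * (12 * n) ^ beta T"
      unfolding ex_planar_def
    proof (rule Max.boundedI[OF finite_copy_numbers])
      show "?X n \<noteq> {}" using planar_hosts_nonempty by simp
      fix c assume "c \<in> ?X n"
      then obtain G :: "nat graph" where G: "planar G" "card (verts G) = n" "c = card (copies T G)"
        by (auto simp: planar_hosts_def)
      have "verts G \<noteq> {}" using G(2) n by auto
      then show "c \<le> K * (12 * n) ^ beta T" using K[OF G(1)] G(2,3) by simp
    qed
    then have "real (ex_planar n T {}) \<le> real (K * (12 * n) ^ beta T)" by (rule of_nat_mono)
    then show ?thesis by (simp add: power_mult_distrib)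
  qed
  have "beta T \<in> {card S |S. independent_set T S \<and> (\<forall>v\<in>S. vertex_degree T v \<le> 2)}"
    unfolding beta_def by (rule Max_in[OF beta_set_finite_nonempty[OF sg]])
  then obtain S where S: "independent_set T S" "\<And>v. v \<in> S \<Longrightarrow> vertex_degree T v \<le> 2" "beta T = card S"
    by blast
  define N where "N = card (verts T)"
  have N: "1 \<le> N" using sg ne by (simp add: N_def simple_graph_def Suc_le_eq card_gt_0_iff)
  \<comment> \<open>With \<open>m = n div N\<close> and \<open>1 \<le> m\<close>,
    \<open>n < N * Suc m \<le> 2 * N * m\<close>, so \<open>m\<close> is at least
    \<open>n / (2 * N)\<close>.\<close>
  define c where "c = (1 / (2 * real N)) ^ beta T"
  have c: "0 < c" using N by (simp add: c_def)
  have lower: "c * real n ^ beta T \<le> real (ex_planar n T {})" if n: "N \<le> n" for n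
  proof -
    define m where "m = n div N"
    have m: "1 \<le> m" "N * m \<le> n" using n N by (simp_all add: m_def div_greater_zero_iff Suc_le_eq)
    obtain H :: "nat graph" where H: "planar H" "card (verts H) = n" "m ^ card S \<le> card (copies T H)"
      using blowup_lower_bound[OF assms S(1,2) m(1) m(2)[unfolded N_def]] by blast
    have "card (copies T H) \<in> ?X n" using H(1,2) by (auto simp: planar_hosts_def)
    then have "card (copies T H) \<le> ex_planar n T {}"
      unfolding ex_planar_def using Max_ge[OF finite_copy_numbers] by blast
    then have "m ^ beta T \<le> ex_planar n T {}" using H(3) S(3) by simp
    then have le: "real m ^ beta T \<le> real (ex_planar n T {})"
      by (metis of_nat_le_iff of_nat_power)
    have "n < N * Suc m" using N by (simp add: m_def dividend_less_times_div)
    also have "\<dots> \<le> N * (2 * m)" using m(1) by (intro mult_le_mono2) simp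
    finally have "real n \<le> real (N * (2 * m))" by (intro of_nat_mono) simp
    then have "1 / (2 * real N) * real n \<le> real m" using N by (simp add: field_simps)
    then have "(1 / (2 * real N) * real n) ^ beta T \<le> real m ^ beta T"
      by (intro power_mono) simp_all
    then show ?thesis using le by (simp only: c_def power_mult_distrib)
  qed
  show ?thesis
  proof (rule bigthetaI)
    show "(\<lambda>n. real (ex_planar n T {})) \<in> O(\<lambda>n. real n ^ beta T)"
      using upper by (intro bigoI[of _ "real (K * 12 ^ beta T)"] eventually_sequentiallyI[of 1]) simp
    show "(\<lambda>n. real (ex_planar n T {})) \<in> \<Omega>(\<lambda>n. real n ^ beta T)"
      using lower c
      by (intro landau_omega.bigI[of c] eventually_sequentiallyI[of N]) simp_all
  qed
qed

end
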